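(* Let $k\ge 2$ be an integer, let $G=\mathrm{BS}(1,k)=\langle a,b\mid b^{-1}ab=a^k\rangle$, and let $\mathsf{NF}\subseteq\{a,A,b,B\}^*$ be the set of normal form words for $G$ (where the letters $A,B$ represent $a^{-1},b^{-1}$). For all fixed $g,h\in G$, the set of conjugators $$\mathsf{Con}_{hg}:=\{w\in\mathsf{NF} : wh=_G gw\}$$ is an EDT0L language.
   Context: Notation: $\mathbb N_0=\{0,1,2,\dots\}$. $=_G$ denotes equality of elements of $G$, words being evaluated in $G$ with $A$ representing $a^{-1}$ and $B$ representing $b^{-1}$. Normal form. Let $k\ge2$. For $i,j\in\mathbb Z$, $j\ge 0$, write $a^{i/k^j}$ for the element $b^ja^ib^{-j}$ of $G=\mathrm{BS}(1,k)$ (so $a^q$ is defined for every $q\in\mathbb Z[1/k]$); $A^q$ means $a^{-q}$. Every $g\in G$ can be written as $g=b^r\alpha^u$ with $r\in\mathbb Z$, $\alpha\in\{a,A\}$, and $$u=\frac{i_m}{k^m}+\frac{i_{m-1}}{k^{m-1}}+\cdots+\frac{i_1}{k}+s,\qquad m,s\in\mathbb N_0,\ i_j\in\{0,\dots,k-1\},$$ where either $m=0$ or $i_m\ne0$. The normal form $\mathsf{NF}(g)$ is the word $$b^{t}\,\alpha^{i_m}B\,\alpha^{i_{m-1}}B\cdots\alpha^{i_1}B\,\alpha^s,\qquad t=r+m,$$ over $\{a,A,b,B\}$, where $b^t$ means the word $B^{|t|}$ if $t<0$. Each $g$ has exactly one such word (when $u=0$ the choice of $\alpha$ is immaterial), and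 $\mathsf{NF}=\{\mathsf{NF}(g):g\in G\}$. EDT0L languages. An EDT0L system is a tuple $(\mathcal V,\mathcal U,\mathcal R,v_0)$ where $\mathcal V$ is a finite alphabet, $\mathcal U\subseteq\mathcal V$ is the set of terminals, $v_0\in\mathcal V^*$ is the start word (axiom), and $\mathcal R$ (the rational control) is a regular subset of $\mathcal T^*$ for some finite set $\mathcal T$ of free monoid endomorphisms $\mathcal V^*\to\mathcal V^*$ (called tables). Endomorphisms act on the right, so a string $\tau_1\tau_2\cdots\tau_n\in\mathcal T^*$ is applied by applying $\tau_1$ first, then $\tau_2$, and so on. The language of the system is $\{v\in\mathcal U^*: v=v_0\mathbf r\text{ for some }\mathbf r\in\mathcal R\}$. A language is EDT0L if it is the language of some EDT0L system. *)

theory Defs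
  imports Complex_Main "HOL-Algebra.Group"
begin

text \<open>\<open>LA\<close> and \<open>LB\<close> stand for the formal inverses of \<open>La\<close> and \<open>Lb\<close>.\<close>

datatype letter = La | LA | Lb | LB

fun letter_inv :: "letter \<Rightarrow> letter" where
  "letter_inv La = LA"
| "letter_inv LA = La"
| "letter_inv Lb = LB"
| "letter_inv LB = Lb"

text \<open>Equality of words in $\mathrm{BS}(1,k)$, the group presented by $\langle a,b \mid b^{-1}ab=a^k\rangle$: the
  congruence on words generated by free cancellation and the defining relation.\<close>

inductive bs_eq :: "nat \<Rightarrow> letter list \<Rightarrow> letter list \<Rightarrow> bool" for k :: nat where
  bs_refl: "bs_eq k u u"
| bs_sym: "bs_eq k u v \<Longrightarrow> bs_eq k v u"
| bs_trans: "bs_eq k u v \<Longrightarrow> bs_eq k v w \<Longrightarrow> bs_eq k u w"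
| bs_cancel: "bs_eq k (u @ [x, letter_inv x] @ v) (u @ v)"
| bs_relator: "bs_eq k (u @ [LB, La, Lb] @ v) (u @ replicate k La @ v)"

definition eval_word :: "nat \<Rightarrow> letter list \<Rightarrow> letter list set" where
  "eval_word k w = {v. bs_eq k w v}"

definition BS :: "nat \<Rightarrow> letter list set monoid" where
  "BS k = \<lparr> carrier = range (eval_word k),
            mult = (\<lambda>X Y. {w. \<exists>x\<in>X. \<exists>y\<in>Y. bs_eq k (x @ y) w}),
            one = eval_word k [] \<rparr>"

lemma bs_eq_append_left: "bs_eq k u v \<Longrightarrow> bs_eq k (p @ u) (p @ v)"
proof (induction rule: bs_eq.induct)
  case (bs_cancel u x v)
  then show ?case using bs_eq.bs_cancel[of k "p @ u" x v] by simp
next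
  case (bs_relator u v)
  then show ?case using bs_eq.bs_relator[of k "p @ u" v] by simp
qed (blast intro: bs_eq.intros)+

lemma bs_eq_append_right: "bs_eq k u v \<Longrightarrow> bs_eq k (u @ p) (v @ p)"
proof (induction rule: bs_eq.induct)
  case (bs_cancel u x v)
  then show ?case using bs_eq.bs_cancel[of k u x "v @ p"] by simp
next
  case (bs_relator u v)
  then show ?case using bs_eq.bs_relator[of k u "v @ p"] by simp
qed (blast intro: bs_eq.intros)+

lemma bs_eq_append: "bs_eq k u v \<Longrightarrow> bs_eq k u' v' \<Longrightarrow> bs_eq k (u @ u') (v @ v')"
  by (meson bs_eq_append_left bs_eq_append_right bs_trans)

lemma eval_word_eq_iff: "eval_word k u = eval_word k v \<longleftrightarrow> bs_eq k u v"
  unfolding eval_word_def by (auto intro: bs_eq.intros)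

lemma eval_word_carrier [simp]: "eval_word k u \<in> carrier (BS k)"
  by (simp add: BS_def)

lemma one_BS: "\<one>\<^bsub>BS k\<^esub> = eval_word k []"
  by (simp add: BS_def)

lemma mult_BS: "eval_word k u \<otimes>\<^bsub>BS k\<^esub> eval_word k v = eval_word k (u @ v)"
  unfolding BS_def eval_word_def
  by (auto intro: bs_trans bs_eq_append bs_refl)

lemma carrier_BS_cases:
  assumes "x \<in> carrier (BS k)"
  obtains u where "x = eval_word k u"
  using assms by (auto simp: BS_def)

lemma letter_inv_letter_inv [simp]: "letter_inv (letter_inv l) = l"
  by (cases l) simp_all

lemma bs_eq_left_inverse: "bs_eq k (rev (map letter_inv u) @ u) []"
proof (induction u)
  case Nil
  show ?case by (simp add: bs_refl)
next
  case (Cons l u)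
  have "bs_eq k (rev (map letter_inv (l # u)) @ l # u) (rev (map letter_inv u) @ u)"
    using bs_cancel[of k "rev (map letter_inv u)" "letter_inv l" u] by simp
  then show ?case using Cons bs_trans by blast
qed

lemma group_BS: "group (BS k)"
proof (rule groupI)
  show "\<one>\<^bsub>BS k\<^esub> \<in> carrier (BS k)"
    by (simp add: one_BS)
next
  fix x y assume "x \<in> carrier (BS k)" "y \<in> carrier (BS k)"
  then show "x \<otimes>\<^bsub>BS k\<^esub> y \<in> carrier (BS k)"
    by (elim carrier_BS_cases) (simp add: mult_BS)
next
  fix x y z assume "x \<in> carrier (BS k)" "y \<in> carrier (BS k)" "z \<in> carrier (BS k)"
  then show "x \<otimes>\<^bsub>BS k\<^esub> y \<otimes>\<^bsub>BS k\<^esub> z = x \<otimes>\<^bsub>BS k\<^esub> (y \<otimes>\<^bsub>BS k\<^esub> z)"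
    by (elim carrier_BS_cases) (simp add: mult_BS)
next
  fix x assume "x \<in> carrier (BS k)"
  then show "\<one>\<^bsub>BS k\<^esub> \<otimes>\<^bsub>BS k\<^esub> x = x"
    by (elim carrier_BS_cases) (simp add: mult_BS one_BS)
next
  fix x assume "x \<in> carrier (BS k)"
  then obtain u where x: "x = eval_word k u" by (rule carrier_BS_cases)
  have "eval_word k (rev (map letter_inv u)) \<otimes>\<^bsub>BS k\<^esub> x = \<one>\<^bsub>BS k\<^esub>"
    by (simp add: x mult_BS one_BS eval_word_eq_iff bs_eq_left_inverse)
  then show "\<exists>y\<in>carrier (BS k). y \<otimes>\<^bsub>BS k\<^esub> x = \<one>\<^bsub>BS k\<^esub>"
    using eval_word_carrier by blast
qed

abbreviation gen_a :: "nat \<Rightarrow> letter list set" where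
  "gen_a k \<equiv> eval_word k [La]"

abbreviation gen_b :: "nat \<Rightarrow> letter list set" where
  "gen_b k \<equiv> eval_word k [Lb]"

definition a_frac :: "nat \<Rightarrow> int \<Rightarrow> nat \<Rightarrow> letter list set" where
  "a_frac k i j =
     gen_b k [^]\<^bsub>BS k\<^esub> int j \<otimes>\<^bsub>BS k\<^esub> gen_a k [^]\<^bsub>BS k\<^esub> i \<otimes>\<^bsub>BS k\<^esub> gen_b k [^]\<^bsub>BS k\<^esub> (- int j)"

text \<open>The element $a^q$; only meaningful for $q \in \mathbb{Z}[1/k]$.\<close>

definition a_pow :: "nat \<Rightarrow> rat \<Rightarrow> letter list set" where
  "a_pow k q = (THE x. \<exists>i j. q = of_int i / of_nat k ^ j \<and> x = a_frac k i j)"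

lemma gen_relation: "gen_a k \<otimes>\<^bsub>BS k\<^esub> gen_b k = gen_b k \<otimes>\<^bsub>BS k\<^esub> gen_a k [^]\<^bsub>BS k\<^esub> k"
proof -
  have pow: "gen_a k [^]\<^bsub>BS k\<^esub> n = eval_word k (replicate n La)" for n :: nat
    by (induction n) (simp_all add: mult_BS one_BS replicate_append_same)
  have "bs_eq k [Lb, LB, La, Lb] [La, Lb]"
    using bs_cancel[of k "[]" Lb "[La, Lb]"] by simp
  moreover have "bs_eq k [Lb, LB, La, Lb] (Lb # replicate k La)"
    using bs_relator[of k "[Lb]" "[]"] by simp
  ultimately show ?thesis
    by (simp add: pow mult_BS eval_word_eq_iff) (meson bs_sym bs_trans)
qed

lemma (in group) conj_int_pow:
  assumes a: "a \<in> carrier G" and b: "b \<in> carrier G" and ab: "a \<otimes> b = b \<otimes> a [^] (k::nat)"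
  shows "b \<otimes> a [^] (i * int k) \<otimes> inv b = a [^] (i::int)"
proof -
  let ?c = "\<lambda>x. b \<otimes> x \<otimes> inv b"
  have cancel: "inv b \<otimes> (b \<otimes> z) = z" if "z \<in> carrier G" for z
    using that b by (simp flip: m_assoc)
  have "?c \<in> hom G G"
    by (rule homI) (use b in \<open>simp_all add: m_assoc cancel\<close>)
  then have "?c ((a [^] k) [^] i) = ?c (a [^] k) [^] i"
    using a by (intro hom_int_pow) (auto simp: is_group)
  moreover have "?c (a [^] k) = a"
    using a b by (simp flip: ab) (simp add: m_assoc)
  moreover have "(a [^] k) [^] i = a [^] (i * int k)"
    using a by (metis int_pow_int int_pow_pow mult.commute)
  ultimately show ?thesis by simp
qed

lemma a_frac_expand: "a_frac k (i * int k ^ n) (j + n) = a_frac k i j"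
proof -
  interpret group "BS k" by (rule group_BS)
  let ?a = "gen_a k" and ?b = "gen_b k"
  have step: "a_frac k (i * int k) (Suc j) = a_frac k i j" for i j
  proof -
    have "?b [^]\<^bsub>BS k\<^esub> int (Suc j) = ?b [^]\<^bsub>BS k\<^esub> int j \<otimes>\<^bsub>BS k\<^esub> ?b"
      by (simp add: int_pow_int del: of_nat_Suc)
    moreover have "?b [^]\<^bsub>BS k\<^esub> (- int (Suc j)) = inv\<^bsub>BS k\<^esub> ?b \<otimes>\<^bsub>BS k\<^esub> ?b [^]\<^bsub>BS k\<^esub> (- int j)"
      by (simp add: int_pow_neg_int inv_mult_group del: of_nat_Suc)
    ultimately have "a_frac k (i * int k) (Suc j) =
        ?b [^]\<^bsub>BS k\<^esub> int j \<otimes>\<^bsub>BS k\<^esub> (?b \<otimes>\<^bsub>BS k\<^esub> ?a [^]\<^bsub>BS k\<^esub> (i * int k) \<otimes>\<^bsub>BS k\<^esub> inv\<^bsub>BS k\<^esub> ?b)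
          \<otimes>\<^bsub>BS k\<^esub> ?b [^]\<^bsub>BS k\<^esub> (- int j)"
      by (simp add: a_frac_def m_assoc del: of_nat_Suc)
    then show ?thesis
      by (simp add: conj_int_pow gen_relation a_frac_def)
  qed
  show ?thesis
  proof (induction n)
    case (Suc n)
    then show ?case using step[of "i * int k ^ n" "j + n"] by (simp add: mult_ac)
  qed simp
qed

text \<open>The definition of $a^q$ does not depend on the representation of $q$ as a fraction.\<close>

lemma a_pow_frac:
  assumes "k > 0"
  shows "a_pow k (of_int i / of_nat k ^ j) = a_frac k i j"
proof -
  have eq: "a_frac k i j = a_frac k i' j'"
    if "of_int i / (of_nat k ^ j :: rat) = of_int i' / of_nat k ^ j'" for i j i' j'
  proof -
    have "of_int (i * int k ^ j') = (of_int (i' * int k ^ j) :: rat)"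
      using that assms by (simp add: field_simps)
    then have "i * int k ^ j' = i' * int k ^ j"
      by (simp only: of_int_eq_iff)
    then show ?thesis
      using a_frac_expand[of k i j' j] a_frac_expand[of k i' j j'] by (simp add: add.commute)
  qed
  show ?thesis
    unfolding a_pow_def by (rule the_equality) (use eq in metis)+
qed

fun letter_sign :: "letter \<Rightarrow> rat" where
  "letter_sign LA = - 1"
| "letter_sign _ = 1"

definition b_word :: "int \<Rightarrow> letter list" where
  "b_word t = (if t \<ge> 0 then replicate (nat t) Lb else replicate (nat (- t)) LB)"

definition NF_word :: "int \<Rightarrow> letter \<Rightarrow> nat \<Rightarrow> (nat \<Rightarrow> nat) \<Rightarrow> nat \<Rightarrow> letter list" where
  "NF_word t \<alpha> m i s =
     b_word t @ concat (map (\<lambda>j. replicate (i j) \<alpha> @ [LB]) (rev [1..<Suc m])) @ replicate s \<alpha>"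

text \<open>\<open>is_NF k g w\<close> says that \<open>w\<close> is a normal form word of \<open>g\<close>. A relation is used because
  the normal form is obtained from a choice of $r, \alpha, m, s, i_1, \dots, i_m$ representing $g$.\<close>

definition is_NF :: "nat \<Rightarrow> letter list set \<Rightarrow> letter list \<Rightarrow> bool" where
  "is_NF k g w \<longleftrightarrow>
     (\<exists>(r::int) \<alpha> (u::rat) (m::nat) (s::nat) (i::nat \<Rightarrow> nat).
        \<alpha> \<in> {La, LA} \<and>
        (\<forall>j\<in>{1..m}. i j < k) \<and> (m = 0 \<or> i m \<noteq> 0) \<and>
        u = (\<Sum>j=1..m. of_nat (i j) / of_nat k ^ j) + of_nat s \<and>
        g = gen_b k [^]\<^bsub>BS k\<^esub> r \<otimes>\<^bsub>BS k\<^esub> a_pow k (letter_sign \<alpha> * u) \<and>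
        w = NF_word (r + int m) \<alpha> m i s)"

definition NF :: "nat \<Rightarrow> letter list set" where
  "NF k = {w. \<exists>g\<in>carrier (BS k). is_NF k g w}"

definition Con :: "nat \<Rightarrow> letter list set \<Rightarrow> letter list set \<Rightarrow> letter list set" where
  "Con k h g = {w \<in> NF k. eval_word k w \<otimes>\<^bsub>BS k\<^esub> h = g \<otimes>\<^bsub>BS k\<^esub> eval_word k w}"

fun nfa_steps :: "('q \<times> 't \<times> 'q) set \<Rightarrow> 'q set \<Rightarrow> 't list \<Rightarrow> 'q set" where
  "nfa_steps \<Delta> S [] = S"
| "nfa_steps \<Delta> S (x # xs) = nfa_steps \<Delta> {q'. \<exists>q\<in>S. (q, x, q') \<in> \<Delta>} xs"

text \<open>Regular subsets of $T^*$: languages of nondeterministic finite automata over \<open>T\<close>.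
  Since the state set is finite, it may be taken to consist of natural numbers.\<close>

definition regular_language :: "'t set \<Rightarrow> 't list set \<Rightarrow> bool" where
  "regular_language T R \<longleftrightarrow>
     (\<exists>(Q :: nat set) \<Delta> I F.
        finite Q \<and> \<Delta> \<subseteq> Q \<times> T \<times> Q \<and> I \<subseteq> Q \<and> F \<subseteq> Q \<and>
        R = {w \<in> lists T. nfa_steps \<Delta> I w \<inter> F \<noteq> {}})"

definition free_monoid_endo :: "'v set \<Rightarrow> ('v list \<Rightarrow> 'v list) \<Rightarrow> bool" where
  "free_monoid_endo V \<tau> \<longleftrightarrow>
     \<tau> \<in> lists V \<rightarrow> lists V \<and> \<tau> [] = [] \<and>
     (\<forall>u\<in>lists V. \<forall>v\<in>lists V. \<tau> (u @ v) = \<tau> u @ \<tau> v)"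

definition EDT0L_system ::
  "'v set \<Rightarrow> 'v set \<Rightarrow> ('v list \<Rightarrow> 'v list) list set \<Rightarrow> 'v list \<Rightarrow> bool" where
  "EDT0L_system V U R v0 \<longleftrightarrow>
     finite V \<and> U \<subseteq> V \<and> v0 \<in> lists V \<and>
     (\<exists>T. finite T \<and> (\<forall>\<tau>\<in>T. free_monoid_endo V \<tau>) \<and> regular_language T R)"

text \<open>Tables act on the right: the first table of the control word is applied first.\<close>

definition EDT0L_language ::
  "'v set \<Rightarrow> ('v list \<Rightarrow> 'v list) list set \<Rightarrow> 'v list \<Rightarrow> 'v list set" where
  "EDT0L_language U R v0 = {v \<in> lists U. \<exists>r\<in>R. v = fold (\<lambda>\<tau> x. \<tau> x) r v0}"

text \<open>The alphabet \<open>V\<close> may contain finitely many symbols that are not letters of the language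
  under consideration. The type \<open>'a + nat\<close> provides arbitrarily many of them.\<close>

definition EDT0L :: "'a list set \<Rightarrow> bool" where
  "EDT0L L \<longleftrightarrow>
     (\<exists>(V :: ('a + nat) set) U R v0.
        EDT0L_system V U R v0 \<and> map Inl ` L = EDT0L_language U R v0)"

end

theory Submission
  imports Defs "HOL-Library.Countable"
begin

text \<open>Write $b^r a^q$ as the pair $(r, q) \in \mathbb{Z} \times \mathbb{Z}[1/k]$, so that $G$ is a
  semidirect product. Then $(r, q)$ conjugates \<open>h\<close> to \<open>g\<close> iff both have the same exponent sum \<open>c\<close> of
  \<open>b\<close> and $q (k^c - 1) = q_g k^r - q_h$. If $c = 0$, this restricts at most \<open>r\<close>, and the normal forms
  with given \<open>r\<close> are generated by tables that add a digit and a letter \<open>b\<close> simultaneously.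

  Let $c \neq 0$, $d = |c|$ and $K = k^d$. If $q_g = 0$, then \<open>q\<close> is constant and \<open>r\<close> is free. Otherwise \<open>r\<close>
  determines \<open>q\<close>, and passing from \<open>r\<close> to \<open>r + d\<close> adds a constant multiple of $k^r$ to \<open>q\<close>. As
  $r \to \infty$, the fractional digits are eventually fixed on each residue class modulo \<open>d\<close>, while
  the integer part grows by a geometric sum with ratio \<open>K\<close>. As $r \to -\infty$, the power of \<open>b\<close> in front
  is fixed and the digits become periodic. So up to finitely many words, \<open>Con\<close> consists of finitely many
  families $u_0 v_1^{n} u_1 v_2^{1 + K + \dots + K^{n-1}}$, and these are generated by iterating one table.\<close>

subsection \<open>EDT0L languages without rational control\<close>

lemma in_Plus_iff [simp]: "Inl a \<in> A <+> B \<longleftrightarrow> a \<in> A" "Inr b \<in> A <+> B \<longleftrightarrow> b \<in> B"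
  by auto

text \<open>Every table used here fixes the terminals, so it is determined by its values on the
  nonterminals.\<close>

definition subst :: "('n \<Rightarrow> ('a + 'm) list) \<Rightarrow> ('a + 'n) list \<Rightarrow> ('a + 'm) list" where
  "subst f w = concat (map (case_sum (\<lambda>a. [Inl a]) f) w)"

lemma subst_simps [simp]:
  "subst f [] = []"
  "subst f (Inl a # w) = Inl a # subst f w"
  "subst f (Inr n # w) = f n @ subst f w"
  "subst f (u @ v) = subst f u @ subst f v"
  by (simp_all add: subst_def)

definition flatten :: "('n \<Rightarrow> 'a list) \<Rightarrow> ('a + 'n) list \<Rightarrow> 'a list" where
  "flatten fin w = concat (map (case_sum (\<lambda>a. [a]) fin) w)"

lemma flatten_simps [simp]:
  "flatten fin [] = []"
  "flatten fin (Inl a # w) = a # flatten fin w"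
  "flatten fin (Inr n # w) = fin n @ flatten fin w"
  "flatten fin (u @ v) = flatten fin u @ flatten fin v"
  by (simp_all add: flatten_def)

lemma flatten_Inl [simp]: "flatten fin (map Inl w) = w"
  by (induction w) simp_all

lemma subst_Inl [simp]: "subst f (map Inl w) = map Inl w"
  by (induction w) simp_all

lemma subst_in_lists:
  assumes "w \<in> lists (UNIV <+> N)" "\<And>n. n \<in> N \<Longrightarrow> f n \<in> lists (UNIV <+> M)"
  shows "subst f w \<in> lists (UNIV <+> M)"
  using assms(1)
proof (induction w)
  case (Cons x w)
  then show ?case using assms(2) by (cases x) auto
qed simp

lemma regular_language_lists: "regular_language T (lists T)"
proof -
  let ?\<Delta> = "{0::nat} \<times> T \<times> {0}"
  have steps: "nfa_steps ?\<Delta> {0} w = {0}" if "\<forall>x\<in>set w. x \<in> T" for w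
    using that
  proof (induction w)
    case (Cons x w)
    moreover from Cons.prems have "{q'. \<exists>q\<in>{0}. (q, x, q') \<in> ?\<Delta>} = {0}" by auto
    ultimately show ?case by simp
  qed simp
  show ?thesis
    unfolding regular_language_def
    by (rule exI[of _ "{0}"], rule exI[of _ ?\<Delta>], rule exI[of _ "{0}"], rule exI[of _ "{0}"])
      (auto simp: steps)
qed

text \<open>Nonterminals of a countable type are renamed to natural numbers, as \<open>EDT0L\<close>
  requires. The renaming commutes with every table and fixes terminal words, so the same terminal
  words are derived.\<close>

lemma EDT0L_tables:
  fixes v :: "('a::finite + 'n::countable) list"
  assumes "finite N" "v \<in> lists (UNIV <+> N)" "finite E"
    and closed: "\<And>f n. f \<in> E \<Longrightarrow> n \<in> N \<Longrightarrow> f n \<in> lists (UNIV <+> N)"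
  shows "EDT0L {w. \<exists>fs\<in>lists E. map Inl w = fold subst fs v}"
proof -
  let ?e = "map (map_sum (\<lambda>a. a) to_nat) :: ('a + 'n) list \<Rightarrow> ('a + nat) list"
  let ?t = "\<lambda>f. subst (\<lambda>i. ?e (f (from_nat i))) :: ('a + nat) list \<Rightarrow> _"
  let ?V = "UNIV <+> to_nat ` N :: ('a + nat) set"
  have enc: "?t f (?e w) = ?e (subst f w)" for f and w :: "('a + 'n) list"
  proof (induction w)
    case (Cons x w)
    then show ?case by (cases x) simp_all
  qed simp
  have fold_enc: "fold (\<lambda>\<tau> x. \<tau> x) (map ?t fs) (?e w) = ?e (fold subst fs w)" for fs w
    by (induction fs arbitrary: w) (simp_all add: enc)
  have e_lists: "?e w \<in> lists ?V" if "w \<in> lists (UNIV <+> N)" for w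
    using that by (fastforce simp: in_lists_conv_set Plus_def)
  have endo: "free_monoid_endo ?V (?t f)" if "f \<in> E" for f
    unfolding free_monoid_endo_def
  proof (intro conjI ballI funcsetI)
    fix w assume "w \<in> lists ?V"
    then show "?t f w \<in> lists ?V"
    proof (rule subst_in_lists)
      fix i assume "i \<in> to_nat ` N"
      then obtain n where "i = to_nat n" "n \<in> N" by auto
      then show "?e (f (from_nat i)) \<in> lists ?V"
        using e_lists[OF closed[OF that, of n]] by simp
    qed
  qed simp_all
  have system: "EDT0L_system ?V (range Inl) (lists (?t ` E)) (?e v)"
    unfolding EDT0L_system_def
  proof (intro conjI exI[of _ "?t ` E"] ballI)
    show "finite ?V" using assms(1) by simp
    show "?e v \<in> lists ?V" using assms(2) by (rule e_lists)
  qed (use assms(3) endo in \<open>auto simp: regular_language_lists\<close>)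
  have eq_iff: "map Inl w = ?e u \<longleftrightarrow> map Inl w = u" for w :: "'a list" and u :: "('a + 'n) list"
  proof (induction u arbitrary: w)
    case (Cons x u)
    then show ?case by (cases x; cases w) auto
  qed simp
  have "map Inl ` {w. \<exists>fs\<in>lists E. map Inl w = fold subst fs v} =
      EDT0L_language (range Inl) (lists (?t ` E)) (?e v)" (is "?A = ?B")
  proof (intro equalityI subsetI)
    fix x assume "x \<in> ?A"
    then obtain w fs where w: "x = map Inl w" "fs \<in> lists E" "map Inl w = fold subst fs v"
      by auto
    then have "x = fold (\<lambda>\<tau> x. \<tau> x) (map ?t fs) (?e v)" by (simp add: fold_enc eq_iff)
    moreover have "map ?t fs \<in> lists (?t ` E)" using w by auto
    moreover have "x \<in> lists (range Inl)" using w(1) by auto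
    ultimately show "x \<in> ?B" unfolding EDT0L_language_def by blast
  next
    fix x assume "x \<in> ?B"
    then obtain r where r: "x \<in> lists (range Inl)" "r \<in> lists (?t ` E)"
      "x = fold (\<lambda>\<tau> x. \<tau> x) r (?e v)"
      unfolding EDT0L_language_def by auto
    then obtain fs where fs: "fs \<in> lists E" "r = map ?t fs"
      by (auto simp: lists_image)
    obtain w where w: "x = map Inl w"
      using r(1) by (auto simp: lists_image)
    have "map Inl w = fold subst fs v"
      using r(3) by (simp only: w fs fold_enc eq_iff)
    then show "x \<in> ?A" using w fs by auto
  qed
  then show ?thesis using system unfolding EDT0L_def by blast
qed

text \<open>No rational control is needed: a table that comes too late acts as the identity, because it
  meets neither the start symbol \<^term>\<open>None\<close> nor, after the final substitution, any nonterminal.\<close>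

lemma EDT0L_seeds:
  fixes S :: "('a::finite + 'n::countable) list set" and fin :: "'n \<Rightarrow> 'a list"
  assumes "finite N" "finite S" "S \<subseteq> lists (UNIV <+> N)" "finite E"
    and closed: "\<And>f n. f \<in> E \<Longrightarrow> n \<in> N \<Longrightarrow> f n \<in> lists (UNIV <+> N)"
  shows "EDT0L {w. \<exists>s\<in>S. \<exists>fs\<in>lists E.
    w = flatten fin (fold subst fs s)}"
proof -
  let ?l = "map (map_sum (\<lambda>a. a) Some) :: ('a + 'n) list \<Rightarrow> ('a + 'n option) list"
  \<comment> \<open>\<open>?init s\<close> turns the start symbol \<open>None\<close> into the seed
    \<open>s\<close>; a lifted table leaves \<open>None\<close> alone, and \<open>?fin\<close> is
    the final substitution written as such a table.\<close>
  let ?init = "\<lambda>s n. case n of None \<Rightarrow> ?l s | Some n \<Rightarrow> [Inr (Some n)]"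
  let ?lift = "\<lambda>f n. case n of None \<Rightarrow> [Inr None] | Some n \<Rightarrow> ?l (f n)"
  let ?fin = "?lift (map Inl \<circ> fin)"
  let ?E = "insert ?fin (?init ` S \<union> ?lift ` E)"
  let ?N = "insert None (Some ` N)"
  let ?f = "subst (map Inl \<circ> fin) :: _ \<Rightarrow> ('a + 'n) list"
  have l_lists: "?l w \<in> lists (UNIV <+> ?N)" if "w \<in> lists (UNIV <+> N)" for w
    using that by (fastforce simp: in_lists_conv_set Plus_def)
  have l_Inl: "?l (map Inl w) = map Inl w" for w by simp
  have f_eq: "?f w = map Inl (flatten fin w)" for w
  proof (induction w)
    case (Cons x w)
    then show ?case by (cases x) simp_all
  qed simp
  have lift_l: "subst (?lift f) (?l w) = ?l (subst f w)" for f w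
  proof (induction w)
    case (Cons x w)
    then show ?case by (cases x) simp_all
  qed simp
  have init_l: "subst (?init s) (?l w) = ?l w" for s w
  proof (induction w)
    case (Cons x w)
    then show ?case by (cases x) simp_all
  qed simp
  have l_eq: "map Inl w = ?l u \<longleftrightarrow> map Inl w = u" for w u
  proof (induction u arbitrary: w)
    case (Cons x u)
    then show ?case by (cases x; cases w) auto
  qed simp
  have fold_l: "fold subst (map ?lift fs) (?l w) = ?l (fold subst fs w)" for fs w
    by (induction fs arbitrary: w) (simp_all add: lift_l)
  let ?R = "{x. \<exists>s\<in>S. \<exists>fs\<in>lists E. x = fold subst fs s}"
  \<comment> \<open>A derivation passes through three stages: the start symbol, words derived from a
    seed, and their images under the final substitution.\<close>
  let ?Inv = "{[Inr None]} \<union> ?l ` ?R \<union> map Inl ` {w. map Inl w \<in> ?f ` ?R}"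
  have step: "subst \<phi> x \<in> ?Inv" if x: "x \<in> ?Inv" and \<phi>: "\<phi> \<in> ?E" for x \<phi>
  proof -
    consider "x = [Inr None]" | u where "x = ?l u" "u \<in> ?R"
      | w where "x = map Inl w" "map Inl w \<in> ?f ` ?R"
      using x by blast
    then show ?thesis
    proof cases
      case 1
      have seeds: "s \<in> ?R" if "s \<in> S" for s
      proof -
        have "[] \<in> lists E" "s = fold subst [] s" by simp_all
        then show ?thesis using that by blast
      qed
      from \<phi> consider "\<phi> = ?fin" | s where "s \<in> S" "\<phi> = ?init s" | f where "\<phi> = ?lift f" by blast
      then show ?thesis
      proof cases
        case (2 s)
        then have "subst \<phi> x = ?l s" using 1 by simp
        then show ?thesis using seeds[OF 2(1)] by blast
      qed (use 1 in simp_all)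
    next
      case (2 u)
      from \<phi> consider "\<phi> = ?fin" | s where "s \<in> S" "\<phi> = ?init s" | f where "f \<in> E" "\<phi> = ?lift f"
        by blast
      then show ?thesis
      proof cases
        case 1
        obtain w where w: "?f u = map Inl w" by (rule that[OF f_eq])
        have "subst \<phi> x = map Inl w" by (simp only: 1 2(1) lift_l w l_Inl)
        moreover have "map Inl w \<in> ?f ` ?R"
          by (rule image_eqI[where x = u]) (simp only: w, rule 2(2))
        ultimately show ?thesis by blast
      next
        case (2 s)
        then have "subst \<phi> x = x" using \<open>x = ?l u\<close> by (simp only: init_l)
        then show ?thesis using x by simp
      next
        case (3 f)
        obtain s fs where "s \<in> S" "fs \<in> lists E" "u = fold subst fs s" using 2 by auto
        then have "subst f u \<in> ?R" using 3
          by (intro CollectI bexI[of _ s] bexI[of _ "fs @ [f]"]) auto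
        moreover have "subst \<phi> x = ?l (subst f u)" using 3 2 by (simp only: lift_l)
        ultimately show ?thesis by blast
      qed
    next
      case (3 w)
      then have "subst \<phi> x = x" by simp
      then show ?thesis using x by simp
    qed
  qed
  have inv: "fold subst fs x \<in> ?Inv" if "fs \<in> lists ?E" "x \<in> ?Inv" for fs x
    using that
  proof (induction fs arbitrary: x rule: lists.induct)
    case (Cons \<phi> fs)
    have "fold subst (\<phi> # fs) x = fold subst fs (subst \<phi> x)" by simp
    then show ?case using Cons.IH[OF step[OF Cons.prems Cons.hyps(1)]] by (simp only:)
  qed (simp only: fold.simps id_apply)
  have "EDT0L {w. \<exists>fs\<in>lists ?E. map Inl w = fold subst fs [Inr None]}"
  proof (rule EDT0L_tables)
    show "finite ?N" "finite ?E" using assms(1,2,4) by auto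
    show "[Inr None] \<in> lists (UNIV <+> ?N)" by simp
    fix f n assume f: "f \<in> ?E" and n: "n \<in> ?N"
    show "f n \<in> lists (UNIV <+> ?N)"
    proof (cases n)
      case None
      from f consider "f = ?fin" | s where "s \<in> S" "f = ?init s" | g where "f = ?lift g" by blast
      then show ?thesis
        by cases (use None l_lists assms(3) in auto)
    next
      case (Some i)
      from f consider "f = ?fin" | s where "s \<in> S" "f = ?init s" | g where "g \<in> E" "f = ?lift g"
        by blast
      then show ?thesis
      proof cases
        case 3
        then show ?thesis using Some n l_lists[OF closed, of g i] by auto
      qed (use Some n in auto)
    qed
  qed
  moreover have "(\<exists>fs\<in>lists ?E. map Inl w = fold subst fs [Inr None]) \<longleftrightarrow>
      (\<exists>s\<in>S. \<exists>fs\<in>lists E. map Inl w = ?f (fold subst fs s))" for w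
  proof
    assume "\<exists>fs\<in>lists ?E. map Inl w = fold subst fs [Inr None]"
    then have "map Inl w \<in> ?Inv" using inv[of _ "[Inr None]"] by force
    moreover have "map Inl w \<noteq> [Inr None :: 'a + 'n option]" by (cases w) auto
    moreover have "map Inl w \<in> ?f ` ?R" if "map Inl w \<in> map Inl ` {w. map Inl w \<in> ?f ` ?R}"
      using that by (simp only: inj_image_mem_iff[OF inj_mapI[OF inj_Inl]] mem_Collect_eq)
    ultimately consider u where "map Inl w = ?l u" "u \<in> ?R" | "map Inl w \<in> ?f ` ?R"
      by blast
    then show "\<exists>s\<in>S. \<exists>fs\<in>lists E. map Inl w = ?f (fold subst fs s)"
    proof cases
      \<comment> \<open>If no nonterminal is left, the final substitution changes nothing, so a
        derivation that omits \<open>?fin\<close> yields no new word.\<close>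
      case (1 u)
      then have "map Inl w = ?f u" by (simp only: l_eq) (metis subst_Inl)
      then show ?thesis using 1 by auto
    qed auto
  next
    assume "\<exists>s\<in>S. \<exists>fs\<in>lists E. map Inl w = ?f (fold subst fs s)"
    then obtain s fs where s: "s \<in> S" "fs \<in> lists E" "map Inl w = ?f (fold subst fs s)"
      by blast
    have "fold subst (?init s # map ?lift fs @ [?fin]) [Inr None] =
        subst ?fin (fold subst (map ?lift fs) (?l s))" by simp
    also have "\<dots> = map Inl w" by (simp only: fold_l lift_l s(3)[symmetric] l_Inl)
    finally show "\<exists>fs\<in>lists ?E. map Inl w = fold subst fs [Inr None]"
      using s by (intro bexI[of _ "?init s # map ?lift fs @ [?fin]"]) auto
  qed
  moreover have "map Inl w = ?f u \<longleftrightarrow> w = flatten fin u" for w u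
    by (simp only: f_eq inj_map_eq_map[OF inj_Inl])
  ultimately show ?thesis by simp
qed

subsection \<open>Languages given by patterns\<close>

text \<open>The sum $1 + K + ... + K^{n-1}$ in Horner form, which is how repeated use of one table
  produces it.\<close>

fun geo :: "nat \<Rightarrow> nat \<Rightarrow> nat" where
  "geo K 0 = 0"
| "geo K (Suc n) = K * geo K n + 1"

lemma geo_Suc': "geo K (Suc n) = geo K n + K ^ n"
  by (induction n) (simp_all add: algebra_simps)

lemma geo_closed: "(int K - 1) * int (geo K n) = int K ^ n - 1"
  by (induction n) (simp_all add: algebra_simps)

section \<open>Powers of words\<close>

definition word_power :: "'a list \<Rightarrow> nat \<Rightarrow> 'a list" where
  "word_power w n = concat (replicate n w)"

lemma word_power_simps [simp]:
  "word_power w 0 = []"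
  "word_power w (Suc n) = w @ word_power w n"
  by (simp_all add: word_power_def)

lemma word_power_add: "word_power w (m + n) = word_power w m @ word_power w n"
  by (simp add: word_power_def replicate_add)

lemma word_power_mult: "word_power w (m * n) = word_power (word_power w m) n"
  by (induction n) (simp_all add: word_power_add)

lemma word_power_commute: "word_power w n @ w = w @ word_power w n"
  by (induction n) simp_all

lemma word_power_singleton: "word_power [x] n = replicate n x"
  by (induction n) simp_all

lemma word_power_replicate: "word_power (replicate m x) n = replicate (m * n) x"
  by (simp add: word_power_mult flip: word_power_singleton)

text \<open>Nonterminals remember the word they produce, so the one table \<open>grow K\<close>
  serves all patterns at once.\<close>

datatype 'a hole = Rep "'a list" | Geo "'a list"

instance hole :: (countable) countable
  by countable_datatype

fun fill :: "nat \<Rightarrow> nat \<Rightarrow> 'a hole \<Rightarrow> 'a list" where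
  "fill K n (Rep w) = word_power w n"
| "fill K n (Geo w) = word_power w (geo K n)"

fun grow :: "nat \<Rightarrow> 'a hole \<Rightarrow> ('a + 'a hole) list" where
  "grow K (Rep w) = map Inl w @ [Inr (Rep w)]"
| "grow K (Geo w) = replicate K (Inr (Geo w)) @ map Inl w"

text \<open>All holes of a pattern are filled with the same \<open>n\<close>; this synchrony is what
  iterating a single table provides.\<close>

definition pattern_language :: "nat \<Rightarrow> 'a list set \<Rightarrow> bool" where
  "pattern_language K L \<longleftrightarrow>
     (\<exists>S :: ('a + 'a hole) list set. finite S \<and> L = {flatten (fill K n) p | p n. p \<in> S})"

text \<open>One use of the table performs one step of both recursions: $w w^n = w^{n+1}$ and
  $(w^g)^K w = w^{Kg+1}$.\<close>

lemma flatten_grow: "flatten (fill K n) (subst (grow K) p) = flatten (fill K (Suc n)) p"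
proof -
  have rep: "flatten (fill K n) (replicate m (Inr (Geo w))) = word_power w (m * geo K n)" for m w
    by (induction m) (simp_all add: word_power_add)
  have hole: "flatten (fill K n) (grow K x) = fill K (Suc n) x" for x
    by (cases x) (simp_all add: rep word_power_add del: geo.simps,
        simp add: word_power_add word_power_commute)
  show ?thesis
  proof (induction p)
    case (Cons x p)
    then show ?case by (cases x) (simp_all add: hole del: fill.simps)
  qed simp
qed

lemma flatten_grow_power:
  "flatten (fill K 0) ((subst (grow K) ^^ n) p) = flatten (fill K n) p"
proof (induction n arbitrary: p)
  case (Suc n)
  then show ?case by (simp add: flatten_grow funpow_Suc_right del: funpow.simps)
qed simp

text \<open>Take the patterns as seeds and \<open>grow K\<close> as the only table; a control word
  is then just a number \<open>n\<close>. The nonterminals are the holes that occur in the patterns,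
  since \<open>grow K\<close> never introduces a different hole.\<close>

lemma EDT0L_pattern_language:
  fixes L :: "'a::finite list set"
  assumes "pattern_language K L"
  shows "EDT0L L"
proof -
  obtain S :: "('a + 'a hole) list set" where S: "finite S" "L = {flatten (fill K n) p | p n. p \<in> S}"
    using assms unfolding pattern_language_def by blast
  let ?N = "{x. \<exists>p\<in>S. Inr x \<in> set p}"
  have fin: "finite ?N"
  proof (rule finite_subset)
    show "?N \<subseteq> (\<lambda>x. case x of Inr y \<Rightarrow> y | Inl _ \<Rightarrow> undefined) ` (\<Union>p\<in>S. set p)"
      by (force intro!: image_eqI)
  qed (use S in auto)
  have "EDT0L {w. \<exists>s\<in>S. \<exists>fs\<in>lists {grow K}. w = flatten (fill K 0) (fold subst fs s)}"
  proof (rule EDT0L_seeds)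
    show "S \<subseteq> lists (UNIV <+> ?N)"
    proof (intro subsetI in_listsI ballI)
      fix p x assume "p \<in> S" "x \<in> set p"
      then show "x \<in> UNIV <+> ?N" by (cases x) auto
    qed
  next
    fix f n assume "f \<in> {grow K :: 'a hole \<Rightarrow> _}" "n \<in> ?N"
    then show "f n \<in> lists (UNIV <+> ?N)" by (cases n) auto
  qed (use S fin in auto)
  moreover have "lists {grow K} = range (\<lambda>n. replicate n (grow K) :: ('a hole \<Rightarrow> _) list)"
  proof (intro equalityI subsetI)
    fix fs assume "fs \<in> lists {grow K :: 'a hole \<Rightarrow> _}"
    then have "fs = replicate (length fs) (grow K)"
      by (induction fs) auto
    then show "fs \<in> range (\<lambda>n. replicate n (grow K))" by blast
  qed auto
  ultimately have "EDT0L {w. \<exists>s\<in>S. \<exists>n. w = flatten (fill K n) s}"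
    by (simp add: flatten_grow_power)
  moreover have "L = {w. \<exists>s\<in>S. \<exists>n. w = flatten (fill K n) s}"
    using S(2) by blast
  ultimately show ?thesis by simp
qed

lemma pattern_language_empty: "pattern_language K {}"
  unfolding pattern_language_def by (rule exI[of _ "{}"]) simp

lemma pattern_language_pattern: "pattern_language K (range (\<lambda>n. flatten (fill K n) p))"
  unfolding pattern_language_def by (rule exI[of _ "{p}"]) auto

lemma pattern_language_Un:
  assumes "pattern_language K L" "pattern_language K L'"
  shows "pattern_language K (L \<union> L')"
proof -
  obtain S where S: "finite S" "L = {flatten (fill K n) p | p n. p \<in> S}"
    using assms(1) unfolding pattern_language_def by blast
  obtain S' where S': "finite S'" "L' = {flatten (fill K n) p | p n. p \<in> S'}"
    using assms(2) unfolding pattern_language_def by blast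
  show ?thesis
    unfolding pattern_language_def
    by (rule exI[of _ "S \<union> S'"]) (use S S' in auto)
qed

lemma pattern_language_UN:
  assumes "finite I" "\<And>i. i \<in> I \<Longrightarrow> pattern_language K (L i)"
  shows "pattern_language K (\<Union>i\<in>I. L i)"
  using assms
  by (induction I rule: finite_induct) (auto simp: pattern_language_empty intro!: pattern_language_Un)

lemma pattern_language_finite:
  assumes "finite L"
  shows "pattern_language K L"
proof -
  have "pattern_language K {w}" for w
    using pattern_language_pattern[of K "map Inl w"] by (simp add: image_constant_conv)
  then have "pattern_language K (\<Union>w\<in>L. {w})"
    by (intro pattern_language_UN assms)
  then show ?thesis by simp
qed

text \<open>If nonempty \<open>A n\<close> occur only for bounded \<open>n\<close>, the union is
  finite. Otherwise one pattern describes all large \<open>n\<close>, and finitely many words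
  remain. Nonemptiness at arbitrarily large indices is thus available when the pattern has to be
  found.\<close>

lemma pattern_language_eventually:
  fixes A :: "nat \<Rightarrow> 'a list set"
  assumes unique: "\<And>n v w. v \<in> A n \<Longrightarrow> w \<in> A n \<Longrightarrow> v = w"
    and eventually: "(\<And>b. \<exists>n\<ge>b. A n \<noteq> {}) \<Longrightarrow> \<exists>N p. \<forall>j. flatten (fill K j) p \<in> A (N + j)"
  shows "pattern_language K (\<Union>n. A n)"
proof -
  have fin: "finite (A n)" for n
  proof (cases "A n = {}")
    case False
    then obtain w where "w \<in> A n" by blast
    then have "A n \<subseteq> {w}" using unique by blast
    then show ?thesis by (rule finite_subset) simp
  qed simp
  show ?thesis
  proof (cases "\<forall>b. \<exists>n\<ge>b. A n \<noteq> {}")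
    case True
    then obtain N p where p: "\<And>j. flatten (fill K j) p \<in> A (N + j)"
      using eventually by blast
    have "(\<Union>n. A n) = (\<Union>n<N. A n) \<union> range (\<lambda>j. flatten (fill K j) p)"
    proof (intro equalityI subsetI)
      fix w assume "w \<in> (\<Union>n. A n)"
      then obtain n where n: "w \<in> A n" by blast
      show "w \<in> (\<Union>n<N. A n) \<union> range (\<lambda>j. flatten (fill K j) p)"
      proof (cases "n < N")
        case False
        then have "w = flatten (fill K (n - N)) p"
          using n p[of "n - N"] unique by simp
        then show ?thesis by blast
      qed (use n in blast)
    qed (use p in auto)
    then show ?thesis
      by (simp only:) (intro pattern_language_Un pattern_language_finite pattern_language_pattern,
        simp add: fin)
  next
    case False
    then obtain b where "\<And>n. n \<ge> b \<Longrightarrow> A n = {}" by blast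
    then have "(\<Union>n. A n) = (\<Union>n<b. A n)" by (force simp: not_le)
    then show ?thesis by (simp only:) (intro pattern_language_finite, simp add: fin)
  qed
qed

subsection \<open>The semidirect product structure\<close>

fun letter_bexp :: "letter \<Rightarrow> int" where
  "letter_bexp La = 0"
| "letter_bexp LA = 0"
| "letter_bexp Lb = 1"
| "letter_bexp LB = -1"

fun letter_aval :: "letter \<Rightarrow> rat" where
  "letter_aval La = 1"
| "letter_aval LA = -1"
| "letter_aval Lb = 0"
| "letter_aval LB = 0"

definition bexp :: "letter list \<Rightarrow> int" where
  "bexp w = sum_list (map letter_bexp w)"

text \<open>Together with \<open>bexp w\<close> this gives the coordinates $(r, q)$ of $w = b^r
  a^q$. A letter $a$ in front of $w$ contributes $k^r$ because $a b^r = b^r a^{k^r}$.\<close>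

fun aval :: "nat \<Rightarrow> letter list \<Rightarrow> rat" where
  "aval k [] = 0"
| "aval k (x # w) = letter_aval x * of_nat k powi bexp w + aval k w"

lemma bexp_simps [simp]:
  "bexp [] = 0"
  "bexp (x # w) = letter_bexp x + bexp w"
  "bexp (u @ v) = bexp u + bexp v"
  by (simp_all add: bexp_def)

text \<open>Second coordinate of the product in the semidirect product, $(r, q)(r', q') = (r + r', q
  k^{r'} + q')$.\<close>

lemma aval_append:
  "k > 0 \<Longrightarrow> aval k (u @ v) = aval k u * of_nat k powi bexp v + aval k v"
  by (induction u) (simp_all add: power_int_add algebra_simps)

lemma bexp_replicate [simp]: "bexp (replicate n x) = int n * letter_bexp x"
  by (induction n) (simp_all add: algebra_simps)

lemma aval_replicate:
  assumes "x = La \<or> x = LA"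
  shows "aval k (replicate n x) = of_nat n * letter_aval x"
  using assms by (induction n) (auto simp: algebra_simps)

lemma aval_replicate_b:
  assumes "x = Lb \<or> x = LB"
  shows "aval k (replicate n x) = 0"
  using assms by (induction n) auto

text \<open>It suffices to check the generating pairs of the congruence: a letter and its inverse
  cancel, and $b^{-1} a b$ and $a^k$ both have coordinates $(0, k)$.\<close>

lemma bs_eq_invariants:
  assumes "bs_eq k u v" "k > 0"
  shows "bexp u = bexp v \<and> aval k u = aval k v"
  using assms
proof (induction rule: bs_eq.induct)
  case (bs_cancel u x v)
  then show ?case by (cases x) (simp_all add: aval_append power_int_add)
next
  case (bs_relator u v)
  then show ?case by (simp add: aval_append aval_replicate power_int_add)
qed auto

section \<open>Calculation with the elements $a^q$\<close>

lemma a_frac_mult_a_frac: "a_frac k i j \<otimes>\<^bsub>BS k\<^esub> a_frac k i' j = a_frac k (i + i') j"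
proof -
  interpret group "BS k" by (rule group_BS)
  let ?b = "gen_b k [^]\<^bsub>BS k\<^esub> int j" and ?B = "gen_b k [^]\<^bsub>BS k\<^esub> (- int j)"
  have "?B \<otimes>\<^bsub>BS k\<^esub> ?b = \<one>\<^bsub>BS k\<^esub>"
    by (simp add: int_pow_neg)
  then have "?B \<otimes>\<^bsub>BS k\<^esub> (?b \<otimes>\<^bsub>BS k\<^esub> z) = z" if "z \<in> carrier (BS k)" for z
    using that by (simp flip: m_assoc)
  then show ?thesis
    by (simp add: a_frac_def m_assoc int_pow_mult)
qed

lemma a_frac_carrier [simp]: "a_frac k i j \<in> carrier (BS k)"
proof -
  interpret group "BS k" by (rule group_BS)
  show ?thesis by (simp add: a_frac_def)
qed

lemma a_frac_times_b: "a_frac k i j \<otimes>\<^bsub>BS k\<^esub> gen_b k = gen_b k \<otimes>\<^bsub>BS k\<^esub> a_frac k (i * int k) j"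
proof -
  interpret group "BS k" by (rule group_BS)
  let ?a = "gen_a k" and ?b = "gen_b k"
  \<comment> \<open>The denominator is raised first, so that one \<open>b\<close> can be split off
    from the conjugating power on either side.\<close>
  have "a_frac k i j = a_frac k (i * int k) (j + 1)"
    using a_frac_expand[of k i 1 j] by simp
  also have "\<dots> = ?b \<otimes>\<^bsub>BS k\<^esub> a_frac k (i * int k) j \<otimes>\<^bsub>BS k\<^esub> inv\<^bsub>BS k\<^esub> ?b"
  proof -
    have "?b [^]\<^bsub>BS k\<^esub> (int j + 1) = ?b \<otimes>\<^bsub>BS k\<^esub> ?b [^]\<^bsub>BS k\<^esub> int j"
      using int_pow_mult[of ?b 1 "int j"] by (simp add: add.commute)
    moreover have "?b [^]\<^bsub>BS k\<^esub> (- 1 - int j) = ?b [^]\<^bsub>BS k\<^esub> (- int j) \<otimes>\<^bsub>BS k\<^esub> inv\<^bsub>BS k\<^esub> ?b"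
    proof -
      have e: "- 1 - int j = - int j + (- 1)" by simp
      show ?thesis unfolding e using int_pow_mult[of ?b "- int j" "-1"] int_pow_neg[of ?b 1] by simp
    qed
    ultimately show ?thesis by (simp add: a_frac_def m_assoc add.commute)
  qed
  finally show ?thesis by (simp add: m_assoc)
qed

lemma gen_b_inverse: "inv\<^bsub>BS k\<^esub> gen_b k = eval_word k [LB]"
proof -
  interpret group "BS k" by (rule group_BS)
  have "eval_word k [LB] \<otimes>\<^bsub>BS k\<^esub> gen_b k = \<one>\<^bsub>BS k\<^esub>"
    using bs_cancel[of k "[]" LB "[]"] by (simp add: mult_BS one_BS eval_word_eq_iff)
  then show ?thesis by (simp add: inv_equality)
qed

lemma gen_a_inverse: "inv\<^bsub>BS k\<^esub> gen_a k = eval_word k [LA]"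
proof -
  interpret group "BS k" by (rule group_BS)
  have "eval_word k [LA] \<otimes>\<^bsub>BS k\<^esub> gen_a k = \<one>\<^bsub>BS k\<^esub>"
    using bs_cancel[of k "[]" LA "[]"] by (simp add: mult_BS one_BS eval_word_eq_iff)
  then show ?thesis by (simp add: inv_equality)
qed

lemma a_frac_times_B:
  "a_frac k i j \<otimes>\<^bsub>BS k\<^esub> eval_word k [LB] = eval_word k [LB] \<otimes>\<^bsub>BS k\<^esub> a_frac k i (j + 1)"
proof -
  interpret group "BS k" by (rule group_BS)
  have "gen_b k \<otimes>\<^bsub>BS k\<^esub> a_frac k i j = a_frac k i (j + 1) \<otimes>\<^bsub>BS k\<^esub> gen_b k"
    using a_frac_times_b[of k i "j + 1"] a_frac_expand[of k i 1 j] by simp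
  moreover have "inv\<^bsub>BS k\<^esub> gen_b k \<otimes>\<^bsub>BS k\<^esub> (gen_b k \<otimes>\<^bsub>BS k\<^esub> a_frac k i j) = a_frac k i j"
    by (simp flip: m_assoc)
  ultimately have "a_frac k i j = inv\<^bsub>BS k\<^esub> gen_b k \<otimes>\<^bsub>BS k\<^esub> a_frac k i (j + 1) \<otimes>\<^bsub>BS k\<^esub> gen_b k"
    by (simp add: m_assoc)
  then show ?thesis
    by (simp add: m_assoc flip: gen_b_inverse)
qed

lemma a_frac_letter:
  assumes "x = La \<or> x = LA"
  obtains i where "eval_word k [x] = a_frac k i 0" "of_int i = letter_aval x"
proof -
  interpret group "BS k" by (rule group_BS)
  from assms show ?thesis
  proof
    assume "x = La"
    then show ?thesis using that[of 1] by (simp add: a_frac_def)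
  next
    assume "x = LA"
    then show ?thesis using that[of "-1"] int_pow_neg[of "gen_a k" 1]
      by (simp add: a_frac_def gen_a_inverse)
  qed
qed

text \<open>A letter appended to $b^r a^q$ is moved into place: passing $b$ to the left of $a^q$
  multiplies $q$ by $k$, passing its inverse divides $q$ by $k$, and $a$ or its inverse changes $q$
  by 1.\<close>

lemma eval_word_canonical:
  assumes "k > 0"
  shows "\<exists>i j. aval k w = of_int i / of_nat k ^ j \<and>
    eval_word k w = gen_b k [^]\<^bsub>BS k\<^esub> bexp w \<otimes>\<^bsub>BS k\<^esub> a_frac k i j"
proof -
  interpret group "BS k" by (rule group_BS)
  show ?thesis
  proof (induction w rule: rev_induct)
    case Nil
    have "a_frac k 0 0 = \<one>\<^bsub>BS k\<^esub>" by (simp add: a_frac_def)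
    then show ?case by (intro exI[of _ 0]) (simp add: one_BS)
  next
    case (snoc x w)
    then obtain i j where w: "aval k w = of_int i / of_nat k ^ j"
      "eval_word k w = gen_b k [^]\<^bsub>BS k\<^esub> bexp w \<otimes>\<^bsub>BS k\<^esub> a_frac k i j" by blast
    have ev: "eval_word k (w @ [x]) =
        gen_b k [^]\<^bsub>BS k\<^esub> bexp w \<otimes>\<^bsub>BS k\<^esub> (a_frac k i j \<otimes>\<^bsub>BS k\<^esub> eval_word k [x])"
      by (simp add: w(2) m_assoc flip: mult_BS)
    have pow: "gen_b k [^]\<^bsub>BS k\<^esub> (m + n) = gen_b k [^]\<^bsub>BS k\<^esub> m \<otimes>\<^bsub>BS k\<^esub> gen_b k [^]\<^bsub>BS k\<^esub> n"
      for m n :: int by (simp add: int_pow_mult)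
    consider "x = La \<or> x = LA" | "x = Lb" | "x = LB" by (cases x) auto
    then show ?case
    proof cases
      case 1
      then obtain i' where i': "eval_word k [x] = a_frac k i' 0" "of_int i' = letter_aval x"
        by (rule a_frac_letter)
      have "letter_bexp x = 0" using 1 by auto
      moreover have "a_frac k i' 0 = a_frac k (i' * int k ^ j) j"
        using a_frac_expand[of k i' j 0] by simp
      ultimately show ?thesis
        using assms i' w ev
        by (intro exI[of _ "i + i' * int k ^ j"] exI[of _ j])
          (simp add: a_frac_mult_a_frac aval_append field_simps)
    next
      case 2
      then show ?thesis
        using assms w ev
        by (intro exI[of _ "i * int k"] exI[of _ j])
          (simp add: a_frac_times_b aval_append pow m_assoc)
    next
      case 3
      moreover have "gen_b k [^]\<^bsub>BS k\<^esub> (-1 :: int) = eval_word k [LB]"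
        using int_pow_neg[of "gen_b k" 1] by (simp add: gen_b_inverse)
      ultimately show ?thesis
        using assms w ev pow[of "bexp w" "-1"]
        by (intro exI[of _ i] exI[of _ "Suc j"])
          (simp add: a_frac_times_B aval_append m_assoc power_int_minus field_simps)
    qed
  qed
qed

text \<open>For the converse of invariance, both words are brought to the form $b^r a^q$; the
  element $a^q$ does not depend on the fraction chosen for $q$.\<close>

lemma eval_word_eq_iff_invariants:
  assumes "k > 0"
  shows "eval_word k u = eval_word k v \<longleftrightarrow> bexp u = bexp v \<and> aval k u = aval k v"
proof
  assume "eval_word k u = eval_word k v"
  then show "bexp u = bexp v \<and> aval k u = aval k v"
    using bs_eq_invariants[OF _ assms] by (simp add: eval_word_eq_iff)
next
  assume eq: "bexp u = bexp v \<and> aval k u = aval k v"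
  obtain i j where u: "aval k u = of_int i / of_nat k ^ j"
    "eval_word k u = gen_b k [^]\<^bsub>BS k\<^esub> bexp u \<otimes>\<^bsub>BS k\<^esub> a_frac k i j"
    using eval_word_canonical[OF assms] by blast
  obtain i' j' where v: "aval k v = of_int i' / of_nat k ^ j'"
    "eval_word k v = gen_b k [^]\<^bsub>BS k\<^esub> bexp v \<otimes>\<^bsub>BS k\<^esub> a_frac k i' j'"
    using eval_word_canonical[OF assms] by blast
  have "a_frac k i j = a_frac k i' j'"
    using u(1) v(1) eq a_pow_frac[OF assms] by metis
  then show "eval_word k u = eval_word k v" using u v eq by simp
qed

lemma aval_fraction:
  assumes "k > 0"
  obtains i j where "aval k w = of_int i / of_nat k ^ j"
  using eval_word_canonical[OF assms] by blast

subsection \<open>Normal forms\<close>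

text \<open>With $I = k^m u$, the least significant digit $i_m$ comes first, as in the normal form.\<close>

definition digits :: "nat \<Rightarrow> letter \<Rightarrow> nat \<Rightarrow> nat \<Rightarrow> letter list" where
  "digits k \<alpha> m I = concat (map (\<lambda>j. replicate ((I div k ^ j) mod k) \<alpha> @ [LB]) [0..<m])"

definition nf_digits :: "nat \<Rightarrow> letter \<Rightarrow> nat \<Rightarrow> nat \<Rightarrow> letter list" where
  "nf_digits k \<alpha> m I = digits k \<alpha> m I @ replicate (I div k ^ m) \<alpha>"

text \<open>Encodes that $i_m$ is nonzero: as $I = k^m u$, the digit $i_m$ is the residue of $I$
  modulo $k$.\<close>

definition reduced :: "nat \<Rightarrow> nat \<Rightarrow> nat \<Rightarrow> bool" where
  "reduced k m I \<longleftrightarrow> m = 0 \<or> \<not> k dvd I"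

lemma digits_simps:
  "digits k \<alpha> 0 I = []"
  "digits k \<alpha> (Suc m) I = digits k \<alpha> m I @ replicate ((I div k ^ m) mod k) \<alpha> @ [LB]"
  by (simp_all add: digits_def)

lemma digits_add: "digits k \<alpha> (m + n) I = digits k \<alpha> m I @ digits k \<alpha> n (I div k ^ m)"
  by (induction n) (simp_all add: digits_simps power_add div_mult2_eq)

lemma nf_digits_add: "nf_digits k \<alpha> (m + n) I = digits k \<alpha> m I @ nf_digits k \<alpha> n (I div k ^ m)"
  by (simp add: nf_digits_def digits_add power_add div_mult2_eq)

lemma digits_cong:
  "I mod k ^ m = J mod k ^ m \<Longrightarrow> digits k \<alpha> m I = digits k \<alpha> m J"
proof (induction m)
  case (Suc m)
  have mod: "(N mod k ^ Suc m) mod k ^ m = N mod k ^ m" for N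
    by (simp add: mod_mod_cancel)
  have div: "(N mod k ^ Suc m) div k ^ m = (N div k ^ m) mod k" for N
    by (cases "k = 0") (simp_all add: mod_mult2_eq[of N "k ^ m" k] mult.commute[of k])
  show ?case using Suc mod[of I] mod[of J] div[of I] div[of J] by (simp add: digits_simps)
qed (simp add: digits_simps)

section \<open>Coordinates of normal form words\<close>

lemma bexp_digits:
  assumes "\<alpha> = La \<or> \<alpha> = LA"
  shows "bexp (digits k \<alpha> m I) = - int m"
  using assms by (induction m) (auto simp: digits_simps)

lemma aval_digits:
  assumes "\<alpha> = La \<or> \<alpha> = LA" "k > 0"
  shows "aval k (digits k \<alpha> m I) = letter_sign \<alpha> * of_nat (I mod k ^ m) / of_nat k ^ m"
proof (induction m)
  case (Suc m)
  have "I mod k ^ Suc m = k ^ m * (I div k ^ m mod k) + I mod k ^ m"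
    using mod_mult2_eq[of I "k ^ m" k] by (simp add: mult.commute)
  then have "of_nat (I mod k ^ Suc m) =
      (of_nat k ^ m * of_nat (I div k ^ m mod k) + of_nat (I mod k ^ m) :: rat)"
    by (metis of_nat_add of_nat_mult of_nat_power)
  then show ?case
    using Suc assms
    by (auto simp: digits_simps aval_append aval_replicate power_int_minus field_simps)
qed (simp add: digits_simps)

lemma bexp_nf_digits:
  "\<alpha> = La \<or> \<alpha> = LA \<Longrightarrow> bexp (nf_digits k \<alpha> m I) = - int m"
  by (auto simp: nf_digits_def bexp_digits)

lemma aval_nf_digits:
  assumes "\<alpha> = La \<or> \<alpha> = LA" "k > 0"
  shows "aval k (nf_digits k \<alpha> m I) = letter_sign \<alpha> * of_nat I / of_nat k ^ m"
proof -
  have "of_nat I = (of_nat (I div k ^ m) * of_nat k ^ m + of_nat (I mod k ^ m) :: rat)"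
    by (metis div_mult_mod_eq of_nat_add of_nat_mult of_nat_power)
  then show ?thesis
    using assms by (auto simp: nf_digits_def aval_append aval_digits aval_replicate field_simps)
qed

lemma bexp_b_word [simp]: "bexp (b_word t) = t"
  by (simp add: b_word_def)

lemma aval_b_word [simp]: "aval k (b_word t) = 0"
  by (simp add: b_word_def aval_replicate_b)

text \<open>Splits the integer powers of \<open>b\<close> into two families of natural powers, each
  of which a single nonterminal can generate.\<close>

lemma ex_b_word_iff:
  "(\<exists>t. w = b_word t @ v) \<longleftrightarrow> (\<exists>x\<in>{Lb, LB}. \<exists>n. w = replicate n x @ v)"
proof
  assume "\<exists>t. w = b_word t @ v"
  then show "\<exists>x\<in>{Lb, LB}. \<exists>n. w = replicate n x @ v" by (auto simp: b_word_def split: if_splits)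
next
  assume "\<exists>x\<in>{Lb, LB}. \<exists>n. w = replicate n x @ v"
  then obtain n where "w = replicate n Lb @ v \<or> w = replicate n LB @ v" by blast
  then have "w = b_word (int n) @ v \<or> w = b_word (- int n) @ v" by (auto simp: b_word_def)
  then show "\<exists>t. w = b_word t @ v" by blast
qed

text \<open>The induction splits off the lowest digit, \<open>I = f 0 + k * J\<close>, and keeps the
  part \<open>s\<close> above all digits.\<close>

lemma ex_digits:
  "\<forall>j<m. f j < k \<Longrightarrow> \<exists>I. (\<forall>j<m. (I div k ^ j) mod k = f j) \<and> I div k ^ m = (s :: nat)"
proof (induction m arbitrary: f)
  case (Suc m)
  then have "\<forall>j<m. f (Suc j) < k" by simp
  then obtain J where J: "\<forall>j<m. (J div k ^ j) mod k = f (Suc j)" "J div k ^ m = s"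
    using Suc.IH[of "\<lambda>j. f (Suc j)"] by blast
  have f0: "f 0 < k" using Suc.prems by simp
  have "((f 0 + k * J) div k ^ j) mod k = f j" if "j < Suc m" for j
    using that J f0 by (cases j) (simp_all add: div_mult2_eq)
  moreover have "(f 0 + k * J) div k ^ Suc m = s"
    using J f0 by (simp add: div_mult2_eq)
  ultimately show ?case by blast
qed simp

text \<open>The index is reversed because $i_j$ belongs to $k^{-j}$ in $u$, hence to $k^{m-j}$ in $I
  = k^m u$.\<close>

lemma NF_word_eq:
  assumes "\<And>j. j < m \<Longrightarrow> (I div k ^ j) mod k = i (m - j)" "I div k ^ m = s"
  shows "NF_word t \<alpha> m i s = b_word t @ nf_digits k \<alpha> m I"
proof -
  have "rev [1..<Suc m] = map (\<lambda>j. m - j) [0..<m]"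
    by (rule nth_equalityI) (simp_all add: rev_nth del: upt_Suc)
  then show ?thesis
    using assms by (auto simp: NF_word_def nf_digits_def digits_def intro!: arg_cong[of _ _ concat])
qed

lemma a_pow_carrier:
  assumes "k > 0"
  shows "a_pow k (of_int i / of_nat k ^ j) \<in> carrier (BS k)"
  by (simp add: a_pow_frac[OF assms])

text \<open>Shows that the exponent in a normal form lies in $Z[1/k]$, where \<open>a_pow\<close>
  has a meaning.\<close>

lemma ex_fraction_sum:
  assumes "k > 0"
  shows "\<exists>n. (\<Sum>j=1..m. of_nat (i j) / of_nat k ^ j) = (of_int n / of_nat k ^ m :: rat)"
proof (induction m)
  case 0
  show ?case by (rule exI[of _ 0]) simp
next
  case (Suc m)
  then obtain n where "(\<Sum>j=1..m. of_nat (i j) / of_nat k ^ j) = (of_int n / of_nat k ^ m :: rat)"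
    by blast
  then show ?case
    using assms by (intro exI[of _ "n * int k + int (i (Suc m))"]) (simp add: field_simps)
qed

text \<open>The data $i_1, ..., i_m, s$ are packed into the single number $I = k^m u$, and $t = r +
  m$ replaces $r$. Every choice of these data defines an element \<open>g\<close>.\<close>

lemma NF_eq:
  assumes "k > 0"
  shows "NF k = {b_word t @ nf_digits k \<alpha> m I | t \<alpha> m I. (\<alpha> = La \<or> \<alpha> = LA) \<and> reduced k m I}"
proof (intro equalityI subsetI)
  fix w assume "w \<in> NF k"
  then obtain r \<alpha> m s i where *: "\<alpha> \<in> {La, LA}" "\<forall>j\<in>{1..m}. i j < k" "m = 0 \<or> i m \<noteq> 0"
    "w = NF_word (r + int m) \<alpha> m i s"
    unfolding NF_def is_NF_def by blast
  have "\<forall>j<m. i (m - j) < k" using *(2) by auto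
  then obtain I where I: "\<forall>j<m. (I div k ^ j) mod k = i (m - j)" "I div k ^ m = s"
    using ex_digits[of m "\<lambda>j. i (m - j)" k s] by blast
  have "reduced k m I"
    using I(1) *(3) by (auto simp: reduced_def elim!: allE[of _ 0])
  moreover have "w = b_word (r + int m) @ nf_digits k \<alpha> m I"
    using *(4) I NF_word_eq by simp
  ultimately show "w \<in> {b_word t @ nf_digits k \<alpha> m I | t \<alpha> m I.
      (\<alpha> = La \<or> \<alpha> = LA) \<and> reduced k m I}"
    using *(1) by blast
next
  interpret group "BS k" by (rule group_BS)
  fix w assume "w \<in> {b_word t @ nf_digits k \<alpha> m I | t \<alpha> m I.
      (\<alpha> = La \<or> \<alpha> = LA) \<and> reduced k m I}"
  then obtain t \<alpha> m I where *: "w = b_word t @ nf_digits k \<alpha> m I" "\<alpha> = La \<or> \<alpha> = LA"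
    "reduced k m I" by blast
  define i where "i j = (I div k ^ (m - j)) mod k" for j
  define s where "s = I div k ^ m"
  define u :: rat where "u = (\<Sum>j=1..m. of_nat (i j) / of_nat k ^ j) + of_nat s"
  define g where "g = gen_b k [^]\<^bsub>BS k\<^esub> (t - int m) \<otimes>\<^bsub>BS k\<^esub> a_pow k (letter_sign \<alpha> * u)"
  obtain n where "(\<Sum>j=1..m. of_nat (i j) / of_nat k ^ j) = (of_int n / of_nat k ^ m :: rat)"
    using ex_fraction_sum[OF assms] by blast
  then have "u = of_int (n + int s * int k ^ m) / of_nat k ^ m"
    using assms by (simp add: u_def field_simps)
  then obtain n' where "letter_sign \<alpha> * u = of_int n' / of_nat k ^ m"
    using *(2) by (metis letter_sign.simps(1,2) minus_divide_left mult_1 mult_minus1 of_int_minus)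
  then have g: "g \<in> carrier (BS k)"
    by (simp add: g_def a_pow_carrier[OF assms])
  have w: "w = NF_word t \<alpha> m i s"
    unfolding *(1) by (rule NF_word_eq[symmetric]) (auto simp: i_def s_def)
  have "is_NF k g w"
    unfolding is_NF_def
    by (rule exI[of _ "t - int m"], rule exI[of _ \<alpha>], rule exI[of _ u], rule exI[of _ m],
        rule exI[of _ s], rule exI[of _ i])
      (use *(2,3) assms w in \<open>auto simp: u_def g_def i_def reduced_def dvd_eq_mod_eq_0\<close>)
  then show "w \<in> NF k" using g unfolding NF_def by blast
qed

text \<open>With $r = t - m$, with $q$ the signed fraction $I/k^m$, and with $c$ the common exponent
  sum of $b$, the products $wh$ and $gw$ have second coordinates $q k^c + q_h$ and $q_g k^r +
  q$.\<close>

lemma Con_eq: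
  assumes "k > 0"
  shows "Con k (eval_word k v) (eval_word k u) =
    {b_word t @ nf_digits k \<alpha> m I | t \<alpha> m I. (\<alpha> = La \<or> \<alpha> = LA) \<and> reduced k m I \<and> bexp u = bexp v \<and>
      letter_sign \<alpha> * of_nat I / of_nat k ^ m * (of_nat k powi bexp v - 1) =
        aval k u * of_nat k powi (t - int m) - aval k v}"
proof -
  have "eval_word k w \<otimes>\<^bsub>BS k\<^esub> eval_word k v = eval_word k u \<otimes>\<^bsub>BS k\<^esub> eval_word k w \<longleftrightarrow>
      bexp u = bexp v \<and> letter_sign \<alpha> * of_nat I / of_nat k ^ m * (of_nat k powi bexp v - 1) =
        aval k u * of_nat k powi (t - int m) - aval k v"
    if "w = b_word t @ nf_digits k \<alpha> m I" "\<alpha> = La \<or> \<alpha> = LA" for w t \<alpha> m I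
  proof -
    have "t - int m = bexp w" "letter_sign \<alpha> * of_nat I / of_nat k ^ m = aval k w"
      using that assms by (simp_all add: bexp_nf_digits aval_append aval_nf_digits)
    then show ?thesis
      using assms unfolding mult_BS by (auto simp: eval_word_eq_iff_invariants aval_append algebra_simps)
  qed
  then show ?thesis unfolding Con_def NF_eq[OF assms] by blast
qed

subsection \<open>Tables that generate normal forms\<close>

definition blocks :: "letter \<Rightarrow> nat list \<Rightarrow> letter list" where
  "blocks \<alpha> js = concat (map (\<lambda>j. replicate j \<alpha> @ [LB]) js)"

lemma blocks_simps [simp]:
  "blocks \<alpha> [] = []"
  "blocks \<alpha> (j # js) = replicate j \<alpha> @ LB # blocks \<alpha> js"
  by (simp_all add: blocks_def)

text \<open>Digits are listed from the lowest one, $i_m$, so the head carries the condition of being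
  nonzero.\<close>

definition digit_list :: "nat \<Rightarrow> nat list \<Rightarrow> bool" where
  "digit_list k js \<longleftrightarrow> set js \<subseteq> {..<k} \<and> (js = [] \<or> hd js \<noteq> 0)"

text \<open>Replaces the number \<open>I\<close> by a list of digits and a tail length, which tables
  can build piece by piece.\<close>

lemma reduced_nf_digits_iff:
  assumes "k > 0"
  shows "(\<exists>I. reduced k m I \<and> x = nf_digits k \<alpha> m I) \<longleftrightarrow>
    (\<exists>js s. length js = m \<and> digit_list k js \<and> x = blocks \<alpha> js @ replicate s \<alpha>)"
proof
  assume "\<exists>I. reduced k m I \<and> x = nf_digits k \<alpha> m I"
  then obtain I where I: "reduced k m I" "x = nf_digits k \<alpha> m I" by blast
  let ?js = "map (\<lambda>j. (I div k ^ j) mod k) [0..<m]"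
  have "digit_list k ?js"
  proof (cases "m = 0")
    case False
    then have "hd ?js = I mod k" by (simp add: hd_map)
    then show ?thesis
      using False I(1) assms by (simp add: digit_list_def reduced_def dvd_eq_mod_eq_0 image_subset_iff)
  qed (simp add: digit_list_def)
  moreover have "x = blocks \<alpha> ?js @ replicate (I div k ^ m) \<alpha>"
    using I(2) by (simp add: nf_digits_def digits_def blocks_def comp_def)
  ultimately show "\<exists>js s. length js = m \<and> digit_list k js \<and> x = blocks \<alpha> js @ replicate s \<alpha>"
    by (intro exI[of _ ?js] exI[of _ "I div k ^ m"]) simp
next
  assume "\<exists>js s. length js = m \<and> digit_list k js \<and> x = blocks \<alpha> js @ replicate s \<alpha>"
  then obtain js s where js: "length js = m" "digit_list k js" "x = blocks \<alpha> js @ replicate s \<alpha>"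
    by blast
  have "\<forall>j<m. js ! j < k"
    using js by (auto simp: digit_list_def subset_iff)
  then obtain I where I: "\<forall>j<m. (I div k ^ j) mod k = js ! j" "I div k ^ m = s"
    using ex_digits[of m "nth js" k s] by blast
  have "map (\<lambda>j. (I div k ^ j) mod k) [0..<m] = js"
    using I(1) js(1) by (auto intro: nth_equalityI)
  then have "x = nf_digits k \<alpha> m I"
    using I(2) js(3) by (auto simp: nf_digits_def digits_def blocks_def comp_def)
  moreover have "reduced k m I"
    using I(1) js by (cases js) (auto simp: reduced_def digit_list_def dvd_eq_mod_eq_0)
  ultimately show "\<exists>I. reduced k m I \<and> x = nf_digits k \<alpha> m I" by blast
qed

text \<open>\<^term>\<open>Shift t\<close> stands for a power of \<open>b\<close> whose exponent is tied to the number of digits,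
  \<^term>\<open>Power x\<close> for an independent power of \<open>x\<close>.\<close>

instance letter :: finite
proof
  have "(UNIV :: letter set) = {La, LA, Lb, LB}" by (auto intro: letter.exhaust)
  then show "finite (UNIV :: letter set)" by (rule ssubst) simp
qed

datatype marker = Shift int | Power letter | Digits letter | Tail letter

instance marker :: countable
  by countable_datatype

datatype operation = Add_digit nat | Add_tail | Add_power

text \<open>Adding a digit acts on \<open>Digits\<close> and \<open>Shift\<close> simultaneously,
  which ties the power of \<open>b\<close> to the number of digits. Emitted letters cannot be
  cancelled later, so a negative \<open>Shift t\<close> first counts up to 0 without output.\<close>

fun table :: "operation \<Rightarrow> marker \<Rightarrow> (letter + marker) list" where
  "table (Add_digit j) (Shift t) =
     (if t < 0 then [Inr (Shift (t + 1))] else [Inl Lb, Inr (Shift t)])"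
| "table (Add_digit j) (Digits \<alpha>) = map Inl (replicate j \<alpha> @ [LB]) @ [Inr (Digits \<alpha>)]"
| "table Add_tail (Tail \<alpha>) = [Inl \<alpha>, Inr (Tail \<alpha>)]"
| "table Add_power (Power x) = [Inl x, Inr (Power x)]"
| "table _ x = [Inr x]"

fun marker_value :: "marker \<Rightarrow> letter list" where
  "marker_value (Shift t) = b_word t"
| "marker_value _ = []"

fun added_digits :: "operation list \<Rightarrow> nat list" where
  "added_digits [] = []"
| "added_digits (Add_digit j # ops) = j # added_digits ops"
| "added_digits (_ # ops) = added_digits ops"

section \<open>Words derived from the markers\<close>

lemma fold_subst_append [simp]:
  "fold subst fs (u @ v) = fold subst fs u @ fold subst fs v"
  by (induction fs arbitrary: u v) simp_all

lemma fold_subst_Inl [simp]: "fold subst fs (map Inl w) = map Inl w"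
  by (induction fs) simp_all

lemma fold_subst_Cons:
  "fold subst fs (Inl a # w) = Inl a # fold subst fs w"
  "fold subst fs (Inr n # w) = fold subst fs [Inr n] @ fold subst fs w"
  using fold_subst_append[of fs "[Inl a]" w] fold_subst_append[of fs "[Inr n]" w]
    fold_subst_Inl[of fs "[a]"] by simp_all

lemma b_word_plus_one: "t \<ge> 0 \<Longrightarrow> b_word (t + 1) = Lb # b_word t"
  by (simp add: b_word_def nat_add_distrib flip: replicate_Suc)

lemma flatten_Shift:
  "flatten marker_value (fold subst (map table ops) [Inr (Shift t)]) =
     b_word (t + int (length (added_digits ops)))"
proof (induction ops arbitrary: t)
  case (Cons x ops)
  show ?case
  proof (cases x)
    case (Add_digit j)
    then show ?thesis
      using Cons[of t] Cons[of "t + 1"] b_word_plus_one[of "t + int (length (added_digits ops))"]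
      by (simp add: fold_subst_Cons(1) algebra_simps)
  qed (use Cons[of t] in simp_all)
qed simp

lemma flatten_Power:
  "flatten marker_value (fold subst (map table ops) [Inr (Power x)]) =
     replicate (count_list ops Add_power) x"
proof (induction ops)
  case (Cons y ops)
  then show ?case by (cases y) (simp_all add: fold_subst_Cons(1))
qed simp

lemma flatten_Tail:
  "flatten marker_value (fold subst (map table ops) [Inr (Tail \<alpha>)]) =
     replicate (count_list ops Add_tail) \<alpha>"
proof (induction ops)
  case (Cons y ops)
  then show ?case by (cases y) (simp_all add: fold_subst_Cons(1))
qed simp

lemma flatten_Digits:
  "flatten marker_value (fold subst (map table ops) [Inr (Digits \<alpha>)]) =
     blocks \<alpha> (added_digits ops)"
proof (induction ops)
  case (Cons y ops)
  then show ?case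
    by (cases y) (simp_all add: fold_subst_Cons(1) flip: map_replicate)
qed simp

lemma added_digits_append [simp]:
  "added_digits (xs @ ys) = added_digits xs @ added_digits ys"
  by (induction xs rule: added_digits.induct) simp_all

lemma added_digits_map [simp]: "added_digits (map Add_digit js) = js"
  by (induction js) simp_all

lemma added_digits_replicate [simp]:
  "added_digits (replicate n Add_tail) = []" "added_digits (replicate n Add_power) = []"
  by (induction n) simp_all

lemma set_added_digits:
  "ops \<in> lists (Add_digit ` A \<union> {Add_tail, Add_power}) \<Longrightarrow> set (added_digits ops) \<subseteq> A"
  by (induction ops rule: added_digits.induct) auto

lemma EDT0L_operations:
  fixes S :: "(letter + marker) list set"
  assumes "finite S"
  shows "EDT0L {w. \<exists>s\<in>S. \<exists>ops\<in>lists (Add_digit ` {..<k} \<union> {Add_tail, Add_power}).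
    w = flatten marker_value (fold subst (map table ops) s)}"
proof -
  let ?O = "Add_digit ` {..<k} \<union> {Add_tail, Add_power}"
  let ?M = "{x. \<exists>s\<in>S. Inr x \<in> set s}"
  let ?T = "{t. Shift t \<in> ?M}"
  \<comment> \<open>A negative \<open>Shift t\<close> is only ever raised up to
    \<open>Shift 0\<close>, so adding these finitely many markers gives a set closed under all
    tables.\<close>
  let ?N = "?M \<union> (\<Union>t\<in>?T. Shift ` {t..0})"
  have M: "finite ?M"
  proof (rule finite_subset)
    show "?M \<subseteq> (\<lambda>x. case x of Inr y \<Rightarrow> y | Inl _ \<Rightarrow> undefined) ` (\<Union>s\<in>S. set s)"
      by (force intro!: image_eqI)
  qed (use assms in auto)
  have "finite (Shift -` ?M)"
    using M by (rule finite_vimageI) (simp add: inj_def)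
  then have "finite ?T" by (simp add: vimage_def)
  then have N: "finite ?N" using M by simp
  have "EDT0L {w. \<exists>s\<in>S. \<exists>fs\<in>lists (table ` ?O). w = flatten marker_value (fold subst fs s)}"
  proof (rule EDT0L_seeds[OF N assms])
    show "S \<subseteq> lists (UNIV <+> ?N)"
    proof (intro subsetI in_listsI ballI)
      fix s x assume "s \<in> S" "x \<in> set s"
      then show "x \<in> UNIV <+> ?N" by (cases x) auto
    qed
    show "finite (table ` ?O)" by simp
    fix f n assume "f \<in> table ` ?O" and n: "n \<in> ?N"
    then obtain x where f: "f = table x" by blast
    show "f n \<in> lists (UNIV <+> ?N)"
    proof (cases "\<exists>j t. x = Add_digit j \<and> n = Shift t \<and> t < 0")
      case True
      then obtain j t where t: "x = Add_digit j" "n = Shift t" "t < 0" by blast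
      have "\<exists>t'. t' \<in> ?T \<and> t' \<le> t"
      proof (cases "n \<in> ?M")
        case True
        then show ?thesis unfolding t(2) by (intro exI[of _ t]) simp
      next
        case False
        then have "n \<in> (\<Union>t\<in>?T. Shift ` {t..0})" using n by (simp only: Un_iff simp_thms)
        then obtain t' where "t' \<in> ?T" "Shift t \<in> Shift ` {t'..0}" unfolding t(2) by (rule UN_E)
        then show ?thesis by (intro exI[of _ t']) auto
      qed
      then obtain t' where t': "t' \<in> ?T" "t' \<le> t" by (elim exE conjE)
      have "Shift (t + 1) \<in> Shift ` {t'..0}" using t'(2) t(3) by simp
      then have "Shift (t + 1) \<in> ?N" using t'(1) by (intro UnI2 UN_I)
      then show ?thesis using t f by simp
    next
      case False
      then show ?thesis using n f by (cases x; cases n) auto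
    qed
  qed
  moreover have "(\<exists>fs\<in>lists (table ` ?O). w = flatten marker_value (fold subst fs s)) \<longleftrightarrow>
      (\<exists>ops\<in>lists ?O. w = flatten marker_value (fold subst (map table ops) s))" for w s
    unfolding lists_image by blast
  ultimately show ?thesis by simp
qed

lemma operations_exist:
  assumes "set js \<subseteq> {..<k}"
  shows "\<exists>ops\<in>lists (Add_digit ` {..<k} \<union> {Add_tail, Add_power}).
    added_digits ops = js \<and> count_list ops Add_tail = s \<and> count_list ops Add_power = n"
proof
  let ?ops = "map Add_digit js @ replicate s Add_tail @ replicate n Add_power"
  have "count_list (replicate n x) y = (if x = y then n else 0)" for n and x y :: operation
    by (induction n) auto
  moreover have "count_list (map Add_digit js) x = 0" if "x = Add_tail \<or> x = Add_power" for x
    using that by (auto simp: count_list_0_iff)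
  ultimately show "added_digits ?ops = js \<and> count_list ?ops Add_tail = s \<and> count_list ?ops Add_power = n"
    by simp
  show "?ops \<in> lists (Add_digit ` {..<k} \<union> {Add_tail, Add_power})"
    using assms by (auto simp: subset_iff)
qed

text \<open>The prefix \<open>p\<close> serves words without digits, \<open>q\<close> words with at
  least one. The lowest digit, the only one that must be nonzero, is placed in the seed; all later
  digits may be chosen freely.\<close>

definition seeds :: "nat \<Rightarrow> (letter + marker) list \<Rightarrow> (letter + marker) list \<Rightarrow> (letter + marker) list set" where
  "seeds k p q = (\<Union>\<alpha>\<in>{La, LA}. insert (p @ [Inr (Tail \<alpha>)])
     ((\<lambda>j. q @ map Inl (replicate j \<alpha> @ [LB]) @ [Inr (Digits \<alpha>), Inr (Tail \<alpha>)]) ` {1..<k}))"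

lemma seeds_language:
  "(\<exists>s\<in>seeds k p q. w = flatten marker_value (fold subst (map table ops) s)) \<longleftrightarrow>
   (\<exists>\<alpha>\<in>{La, LA}.
      w = flatten marker_value (fold subst (map table ops) p) @
        replicate (count_list ops Add_tail) \<alpha> \<or>
      (\<exists>j\<in>{1..<k}. w = flatten marker_value (fold subst (map table ops) q) @
        blocks \<alpha> (j # added_digits ops) @ replicate (count_list ops Add_tail) \<alpha>))"
proof -
  have [simp]: "fold subst (map table ops) [Inr (Digits \<alpha>), Inr (Tail \<alpha>)] =
      fold subst (map table ops) [Inr (Digits \<alpha>)] @ fold subst (map table ops) [Inr (Tail \<alpha>)]" for \<alpha>
    by (rule fold_subst_Cons(2))
  have "(\<exists>s\<in>seeds k p q. Q s) \<longleftrightarrow> (\<exists>\<alpha>\<in>{La, LA}. Q (p @ [Inr (Tail \<alpha>)]) \<or> (\<exists>j\<in>{1..<k}.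
      Q (q @ map Inl (replicate j \<alpha> @ [LB]) @ [Inr (Digits \<alpha>), Inr (Tail \<alpha>)])))" for Q
    unfolding seeds_def by blast
  then show ?thesis
    by (simp add: flatten_Digits flatten_Tail flip: map_replicate del: map_append bex_simps)
qed

text \<open>\<open>F x n m\<close> is the prefix in front of \<open>m\<close> digits, with a free
  exponent \<open>n\<close>; this covers both powers of \<open>b\<close> independent of
  \<open>m\<close> and powers tied to it. The successor in the condition on \<open>q\<close> counts
  the digit that the seed already contains.\<close>

lemma EDT0L_prefixed_nf_digits:
  fixes p q :: "'x \<Rightarrow> (letter + marker) list" and F :: "'x \<Rightarrow> nat \<Rightarrow> nat \<Rightarrow> letter list"
  assumes "k > 0" "finite X"
    and p: "\<And>x ops. x \<in> X \<Longrightarrow> flatten marker_value (fold subst (map table ops) (p x)) =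
      F x (count_list ops Add_power) 0"
    and q: "\<And>x ops. x \<in> X \<Longrightarrow> flatten marker_value (fold subst (map table ops) (q x)) =
      F x (count_list ops Add_power) (Suc (length (added_digits ops)))"
  shows "EDT0L {F x n m @ nf_digits k \<alpha> m I | x n m \<alpha> I.
    x \<in> X \<and> (\<alpha> = La \<or> \<alpha> = LA) \<and> reduced k m I}"
proof -
  let ?O = "Add_digit ` {..<k} \<union> {Add_tail, Add_power}"
  let ?S = "\<Union>x\<in>X. seeds k (p x) (q x)"
  let ?P = "\<lambda>w. \<exists>s\<in>?S. \<exists>ops\<in>lists ?O. w = flatten marker_value (fold subst (map table ops) s)"
  let ?Q = "\<lambda>w. \<exists>x\<in>X. \<exists>n \<alpha> js s. (\<alpha> = La \<or> \<alpha> = LA) \<and> digit_list k js \<and>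
    w = F x n (length js) @ blocks \<alpha> js @ replicate s \<alpha>"
  have "finite ?S" using assms(2) by (simp add: seeds_def)
  then have EDT0L: "EDT0L {w. ?P w}" by (rule EDT0L_operations)
  have PQ: "?P w \<longleftrightarrow> ?Q w" for w
  proof
    assume "?P w"
    then obtain x ops where x: "x \<in> X" and ops: "ops \<in> lists ?O"
      and "\<exists>s\<in>seeds k (p x) (q x). w = flatten marker_value (fold subst (map table ops) s)"
      by blast
    then obtain \<alpha> where \<alpha>: "\<alpha> = La \<or> \<alpha> = LA"
      and w: "w = F x (count_list ops Add_power) 0 @ replicate (count_list ops Add_tail) \<alpha> \<or>
        (\<exists>j\<in>{1..<k}. w = F x (count_list ops Add_power) (Suc (length (added_digits ops))) @
          blocks \<alpha> (j # added_digits ops) @ replicate (count_list ops Add_tail) \<alpha>)"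
      unfolding seeds_language p[OF x] q[OF x] by blast
    from w show "?Q w"
    proof
      assume "w = F x (count_list ops Add_power) 0 @ replicate (count_list ops Add_tail) \<alpha>"
      then show ?thesis
        using x \<alpha> by (intro bexI[of _ x] exI[of _ "count_list ops Add_power"] exI[of _ \<alpha>]
            exI[of _ "[]"] exI[of _ "count_list ops Add_tail"]) (simp_all add: digit_list_def)
    next
      assume "\<exists>j\<in>{1..<k}. w = F x (count_list ops Add_power) (Suc (length (added_digits ops))) @
          blocks \<alpha> (j # added_digits ops) @ replicate (count_list ops Add_tail) \<alpha>"
      then obtain j where "j \<in> {1..<k}"
        "w = F x (count_list ops Add_power) (length (j # added_digits ops)) @
          blocks \<alpha> (j # added_digits ops) @ replicate (count_list ops Add_tail) \<alpha>" by auto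
      moreover have "digit_list k (j # added_digits ops)"
        using set_added_digits[OF ops] \<open>j \<in> {1..<k}\<close> by (auto simp: digit_list_def)
      ultimately show ?thesis using x \<alpha> by blast
    qed
  next
    assume "?Q w"
    then obtain x n \<alpha> js s where x: "x \<in> X" and \<alpha>: "\<alpha> = La \<or> \<alpha> = LA" and js: "digit_list k js"
      and w: "w = F x n (length js) @ blocks \<alpha> js @ replicate s \<alpha>" by blast
    \<comment> \<open>The head is supplied by the seed, so the operations have to produce the tail
      only.\<close>
    have "set (tl js) \<subseteq> {..<k}"
      using js by (cases js) (auto simp: digit_list_def)
    then obtain ops where ops: "ops \<in> lists ?O" "added_digits ops = tl js"
      "count_list ops Add_tail = s" "count_list ops Add_power = n"
      using operations_exist by blast
    have "w = F x n 0 @ replicate s \<alpha> \<or>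
        (\<exists>j\<in>{1..<k}. w = F x n (Suc (length (tl js))) @ blocks \<alpha> (j # tl js) @ replicate s \<alpha>)"
      using w js by (cases js) (auto simp: digit_list_def intro!: bexI[of _ "hd js"])
    then have "\<exists>s\<in>seeds k (p x) (q x). w = flatten marker_value (fold subst (map table ops) s)"
      unfolding seeds_language p[OF x] q[OF x] ops(2-4) using \<alpha> by blast
    then show "?P w" using x ops(1) by blast
  qed
  have "(\<exists>x n m \<alpha> I. w = F x n m @ nf_digits k \<alpha> m I \<and> x \<in> X \<and> (\<alpha> = La \<or> \<alpha> = LA) \<and> reduced k m I) \<longleftrightarrow>
      ?P w" for w
  proof -
    have "(\<exists>x n m \<alpha> I. w = F x n m @ nf_digits k \<alpha> m I \<and> x \<in> X \<and> (\<alpha> = La \<or> \<alpha> = LA) \<and> reduced k m I) \<longleftrightarrow>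
      (\<exists>x n m \<alpha> v. x \<in> X \<and> (\<alpha> = La \<or> \<alpha> = LA) \<and> (\<exists>I. reduced k m I \<and> v = nf_digits k \<alpha> m I) \<and>
        w = F x n m @ v)" by blast
    also have "\<dots> \<longleftrightarrow> ?Q w"
      unfolding reduced_nf_digits_iff[OF assms(1)] by blast
    finally show ?thesis by (simp only: PQ)
  qed
  then show ?thesis using EDT0L by (simp only:)
qed

lemma EDT0L_NF:
  assumes "k > 0"
  shows "EDT0L (NF k)"
proof -
  have "EDT0L {replicate n x @ nf_digits k \<alpha> m I | x n m \<alpha> I.
      x \<in> {Lb, LB} \<and> (\<alpha> = La \<or> \<alpha> = LA) \<and> reduced k m I}"
    by (rule EDT0L_prefixed_nf_digits[where p = "\<lambda>x. [Inr (Power x)]" and q = "\<lambda>x. [Inr (Power x)]"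
          and F = "\<lambda>x n m. replicate n x"])
      (use assms in \<open>simp_all add: flatten_Power\<close>)
  moreover have "NF k = {w. \<exists>v. (\<exists>t. w = b_word t @ v) \<and>
      (\<exists>\<alpha> m I. v = nf_digits k \<alpha> m I \<and> (\<alpha> = La \<or> \<alpha> = LA) \<and> reduced k m I)}"
    unfolding NF_eq[OF assms] by blast
  moreover have "{replicate n x @ nf_digits k \<alpha> m I | x n m \<alpha> I.
      x \<in> {Lb, LB} \<and> (\<alpha> = La \<or> \<alpha> = LA) \<and> reduced k m I} =
    {w. \<exists>v. (\<exists>x\<in>{Lb, LB}. \<exists>n. w = replicate n x @ v) \<and>
      (\<exists>\<alpha> m I. v = nf_digits k \<alpha> m I \<and> (\<alpha> = La \<or> \<alpha> = LA) \<and> reduced k m I)}"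
    by blast
  ultimately show ?thesis by (simp only: ex_b_word_iff)
qed

lemma EDT0L_fixed_b_exponent:
  assumes "k > 0"
  shows "EDT0L {b_word (r + int m) @ nf_digits k \<alpha> m I | m \<alpha> I. (\<alpha> = La \<or> \<alpha> = LA) \<and> reduced k m I}"
proof -
  \<comment> \<open>\<open>Shift (r + 1)\<close> already accounts for the digit in the seed; the
    unit type gives a one-element index set.\<close>
  have "EDT0L {(\<lambda>(x :: unit) (n :: nat) m. b_word (r + int m)) x n m @ nf_digits k \<alpha> m I | x n m \<alpha> I.
      x \<in> {()} \<and> (\<alpha> = La \<or> \<alpha> = LA) \<and> reduced k m I}"
    by (rule EDT0L_prefixed_nf_digits[where p = "\<lambda>_ :: unit. map Inl (b_word r)"
          and q = "\<lambda>_. [Inr (Shift (r + 1))]" and F = "\<lambda>_ _ m. b_word (r + int m)" and X = "{()}"])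
      (use assms in \<open>simp_all add: flatten_Shift add_ac\<close>)
  then show ?thesis by simp
qed

subsection \<open>The conjugacy equation\<close>

text \<open>The map sending \<open>h\<close> to \<open>(h - y) div K\<close> is monotone, so the
  sequence is monotone in the direction of its first step. As \<open>K\<close> is at least 2, it
  stays bounded, and a bounded monotone sequence of integers becomes constant.\<close>

lemma eventually_constant:
  fixes H :: "nat \<Rightarrow> int"
  assumes step: "\<And>j. H (Suc j) = (H j - y) div K" and nonneg: "\<And>j. H j \<ge> 0" and "K \<ge> 2"
  shows "\<exists>N. \<forall>j\<ge>N. H j = H N"
proof -
  have bound: "H j \<le> max (H 0) \<bar>y\<bar>" for j
  proof (induction j)
    case (Suc j)
    let ?b = "max (H 0) \<bar>y\<bar>"
    have "H (Suc j) * K \<le> H j - y"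
      unfolding step using \<open>K \<ge> 2\<close> by (simp add: mult.commute minus_mod_eq_mult_div[symmetric])
    moreover have "H (Suc j) * 2 \<le> H (Suc j) * K"
      using \<open>K \<ge> 2\<close> nonneg by (intro mult_left_mono) auto
    ultimately have "2 * H (Suc j) \<le> 2 * ?b" using Suc by linarith
    then show ?case by simp
  qed simp
  have "finite (range H)"
    by (rule finite_subset[of _ "{0..max (H 0) \<bar>y\<bar>}"]) (use bound nonneg in auto)
  have mono: "(a - y) div K \<le> (b - y) div K" if "a \<le> b" for a b
    using that \<open>K \<ge> 2\<close> by (intro zdiv_mono1) auto
  consider "H 0 \<le> H 1" | "H 1 \<le> H 0" by linarith
  then show ?thesis
  proof cases
    case 1
    have "H j \<le> H (Suc j)" for j
    proof (induction j)
      case (Suc j)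
      then show ?case using mono[of "H j" "H (Suc j)"] step[of j] step[of "Suc j"] by simp
    qed (use 1 in simp)
    then have inc: "H i \<le> H j" if "i \<le> j" for i j
      using that by (rule lift_Suc_mono_le)
    have "Max (range H) \<in> range H" using \<open>finite (range H)\<close> by (intro Max_in) auto
    then obtain N where "Max (range H) = H N" by blast
    then have "H j \<le> H N" for j using Max_ge[OF \<open>finite (range H)\<close>, of "H j"] by simp
    then show ?thesis using inc by (metis order_antisym)
  next
    case 2
    have "H (Suc j) \<le> H j" for j
    proof (induction j)
      case (Suc j)
      then show ?case using mono[of "H (Suc j)" "H j"] step[of j] step[of "Suc j"] by simp
    qed (use 2 in simp)
    then have dec: "H j \<le> H i" if "i \<le> j" for i j
      using that by (rule lift_Suc_antimono_le)
    have "Min (range H) \<in> range H" using \<open>finite (range H)\<close> by (intro Min_in) auto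
    then obtain N where "Min (range H) = H N" by blast
    then have "H N \<le> H j" for j using Min_le[OF \<open>finite (range H)\<close>, of "H j"] by simp
    then show ?thesis using dec by (metis order_antisym)
  qed
qed

text \<open>If $m < n$, then $J = I k^{n-m}$ would be divisible by $k$; the other case is
  symmetric.\<close>

lemma reduced_unique:
  fixes k m n I J :: nat
  assumes "k > 0" "reduced k m I" "reduced k n J"
    and eq: "of_nat I / of_nat k ^ m = (of_nat J / of_nat k ^ n :: rat)"
  shows "m = n \<and> I = J"
proof -
  have "of_nat (I * k ^ n) = (of_nat (J * k ^ m) :: rat)"
    using eq assms(1) by (simp add: field_simps)
  then have cross: "I * k ^ n = J * k ^ m" by (simp only: of_nat_eq_iff)
  have *: False if "m < n" "I * k ^ n = J * k ^ m" "\<not> k dvd J" for m n I J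
  proof -
    have "k ^ n = k ^ m * k ^ (n - m)" using that(1) by (simp flip: power_add)
    then have "J = I * k ^ (n - m)" using that(2) assms(1) by simp
    moreover have "k dvd k ^ (n - m)" using that(1) by (simp add: dvd_power)
    ultimately show False using that(3) by simp
  qed
  have "m = n"
    using *[of m n I J] *[of n m J I] cross assms(2,3)
    by (cases m n rule: linorder_cases) (auto simp: reduced_def)
  then show ?thesis using cross assms(1) by simp
qed

text \<open>The conjugacy equation for $b^r a^{\pm I/k^m}$ takes this form after clearing denominators and
  signs; \<open>d\<close> is the absolute value of the exponent sum of \<open>b\<close> in the conjugate elements.\<close>

definition solution :: "nat \<Rightarrow> nat \<Rightarrow> int \<Rightarrow> int \<Rightarrow> nat \<Rightarrow> int \<Rightarrow> nat \<Rightarrow> nat \<Rightarrow> bool" where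
  "solution k d p y e r m I \<longleftrightarrow> reduced k m I \<and>
     (of_nat k ^ d - 1) * of_nat I / of_nat k ^ m =
       (of_int p * of_nat k powi r - of_int y) / (of_nat k ^ e :: rat)"

definition solution_words ::
    "letter \<Rightarrow> nat \<Rightarrow> nat \<Rightarrow> int \<Rightarrow> int \<Rightarrow> nat \<Rightarrow> int \<Rightarrow> letter list set" where
  "solution_words \<alpha> k d p y e r =
     {b_word (r + int m) @ nf_digits k \<alpha> m I | m I. solution k d p y e r m I}"

section \<open>Uniqueness and sign of solutions\<close>

lemma solution_wordsI:
  "solution k d p y e r m I \<Longrightarrow> b_word (r + int m) @ nf_digits k \<alpha> m I \<in> solution_words \<alpha> k d p y e r"
  unfolding solution_words_def by blast

text \<open>The factor $k^d - 1$ is nonzero, so the equation determines the fraction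
  $I/k^m$.\<close>

lemma solution_unique:
  assumes "k \<ge> 2" "d \<ge> 1" "solution k d p y e r m I" "solution k d p y e r n J"
  shows "m = n \<and> I = J"
proof -
  have "(of_nat k ^ d :: rat) > 1" using assms(1,2) by (intro one_less_power) auto
  then have "of_nat I / of_nat k ^ m = (of_nat J / of_nat k ^ n :: rat)"
    using assms(3,4) unfolding solution_def by (metis diff_gt_0_iff_gt less_irrefl mult_left_cancel times_divide_eq_right)
  then show ?thesis
    using assms by (intro reduced_unique) (auto simp: solution_def)
qed

lemma solution_words_unique:
  assumes "k \<ge> 2" "d \<ge> 1" "v \<in> solution_words \<alpha> k d p y e r" "w \<in> solution_words \<alpha> k d p y e r"
  shows "v = w"
proof -
  obtain m I where v: "v = b_word (r + int m) @ nf_digits k \<alpha> m I" "solution k d p y e r m I"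
    using assms(3) unfolding solution_words_def by blast
  obtain n J where w: "w = b_word (r + int n) @ nf_digits k \<alpha> n J" "solution k d p y e r n J"
    using assms(4) unfolding solution_words_def by blast
  show ?thesis using solution_unique[OF assms(1,2) v(2) w(2)] v w by simp
qed

text \<open>The left side of the equation is nonnegative because \<open>I\<close> is a natural
  number. This controls the sign of the right side for large and for very negative
  \<open>r\<close>.\<close>

lemma solution_nonneg:
  assumes "k \<ge> 2" "solution k d p y e r m I"
  shows "of_int p * of_nat k powi r - of_int y \<ge> (0 :: rat)"
proof -
  have "(of_nat k ^ d :: rat) \<ge> 1" using assms(1) by (intro one_le_power) auto
  then have "0 \<le> (of_nat k ^ d - 1) * of_nat I / (of_nat k ^ m :: rat)"
    by simp
  then have "0 \<le> (of_int p * of_nat k powi r - of_int y) / (of_nat k ^ e :: rat)"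
    using assms(2) by (simp add: solution_def)
  moreover have "(of_nat k ^ e :: rat) > 0" using assms(1) by simp
  ultimately show ?thesis by (simp only: zero_le_divide_iff) linarith
qed

lemma b_word_add_nat: "t \<ge> 0 \<Longrightarrow> b_word (t + int n) = b_word t @ replicate n Lb"
  by (simp add: b_word_def nat_add_distrib replicate_add)

text \<open>For large \<open>r\<close>, passing from \<open>r\<close> to \<open>r + d\<close> changes the exponent of \<open>a\<close> by the integer
  $p k^{r-e}$, so that the fractional digits stay the same.\<close>

lemma pattern_language_increasing:
  assumes k: "k \<ge> 2" and d: "d \<ge> 1" and p: "p \<noteq> 0"
  shows "pattern_language (k ^ d) (\<Union>n. solution_words \<alpha> k d p y e (int i + int d * int n))"
proof (rule pattern_language_eventually)
  let ?r = "\<lambda>n. int i + int d * int n"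
  let ?A = "\<lambda>n. solution_words \<alpha> k d p y e (?r n)"
  assume inf: "\<And>b. \<exists>n\<ge>b. ?A n \<noteq> {}"
  have r_ge: "int n \<le> ?r n" for n
    using d by (metis add_increasing mult_le_mono1 mult_1 of_nat_0_le_iff of_nat_le_iff of_nat_mult)
  \<comment> \<open>For negative \<open>p\<close>, the value $p k^a$ falls below $y$ as soon as $a$
    is at least $|y|$, since $k^a > a$.\<close>
  have "p > 0"
  proof (rule ccontr)
    assume "\<not> p > 0"
    obtain n m I where n: "n \<ge> nat \<bar>y\<bar>" and sol: "solution k d p y e (?r n) m I"
      using inf[of "nat \<bar>y\<bar>"] unfolding solution_words_def by blast
    define a where "a = i + d * n"
    have a: "?r n = int a" by (simp add: a_def)
    have "of_int p * of_nat k ^ a - of_int y \<ge> (0 :: rat)"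
      using solution_nonneg[OF k sol] by (simp only: a power_int_of_nat)
    then have "(of_int (p * int k ^ a - y) :: rat) \<ge> 0" by simp
    then have "p * int k ^ a \<ge> y" by (simp only: of_int_0_le_iff)
    moreover have "a < k ^ a" using k by (intro less_exp[THEN less_le_trans] power_mono) auto
    then have "int a < int k ^ a" by (metis of_nat_less_iff of_nat_power)
    moreover have "p * int k ^ a \<le> - 1 * int k ^ a"
      using \<open>\<not> p > 0\<close> p by (intro mult_right_mono) auto
    moreover have "\<bar>y\<bar> \<le> int a" using n r_ge[of n] a by linarith
    ultimately show False by linarith
  qed
  obtain n m I where n: "n \<ge> e" and sol: "solution k d p y e (?r n) m I"
    using inf[of e] unfolding solution_words_def by blast
  define a where "a = i + d * n"
  have a: "?r n = int a" by (simp add: a_def)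
  have ae: "a \<ge> e" using n r_ge[of n] a by linarith
  \<comment> \<open>As \<open>a\<close> is at least \<open>e\<close>, this is the integer $p
    k^{a-e}$. Passing from $r = a$ to $r = a + dj$ makes $I/k^m$ grow by $p (k^{a+dj} - k^a) / (k^e
    (k^d - 1))$, which is \<open>N * geo (k ^ d) j\<close>.\<close>
  define N where "N = nat p * k ^ (a - e)"
  define J where "J j = I + k ^ m * (N * geo (k ^ d) j)" for j
  have N: "of_nat N = (of_int p * of_nat k ^ a / of_nat k ^ e :: rat)"
  proof -
    have "(of_nat k ^ a :: rat) = of_nat k ^ (a - e) * of_nat k ^ e"
      using ae by (simp flip: power_add)
    then show ?thesis using \<open>p > 0\<close> k by (simp add: N_def)
  qed
  have sol_J: "solution k d p y e (?r (n + j)) m (J j)" for j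
  proof -
    \<comment> \<open>The added multiple of $k^m$ preserves the lowest digit; for
      \<open>m = 0\<close> every number is reduced.\<close>
    have "m = 0 \<or> k dvd k ^ m * (N * geo (k ^ d) j)" by (cases m) simp_all
    then have "reduced k m (J j)"
      using sol by (auto simp: solution_def reduced_def J_def dvd_add_left_iff)
    moreover have "(of_nat k ^ d - 1) * of_nat (J j) / of_nat k ^ m =
        (of_int p * of_nat k powi ?r (n + j) - of_int y) / (of_nat k ^ e :: rat)"
    proof -
      have "(of_nat k ^ d - 1) * of_nat (geo (k ^ d) j) = ((of_nat k ^ d) ^ j - 1 :: rat)"
        using arg_cong[OF geo_closed[of "k ^ d" j], of "of_int :: int \<Rightarrow> rat"] by simp
      moreover have "(of_nat k ^ d - 1) * of_nat (J j) / of_nat k ^ m =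
          (of_nat k ^ d - 1) * of_nat I / of_nat k ^ m +
            of_nat N * ((of_nat k ^ d - 1) * of_nat (geo (k ^ d) j) :: rat)"
        using k by (simp add: J_def field_simps)
      moreover have "(of_nat k ^ d - 1) * of_nat I / of_nat k ^ m =
          (of_int p * of_nat k ^ a - of_int y) / (of_nat k ^ e :: rat)"
        using sol unfolding solution_def by (simp only: a power_int_of_nat)
      moreover have "?r (n + j) = int (a + d * j)" by (simp add: a_def algebra_simps)
      then have "(of_nat k powi ?r (n + j) :: rat) = of_nat k ^ a * (of_nat k ^ d) ^ j"
        by (simp only: power_int_of_nat power_add power_mult)
      ultimately show ?thesis
        by (simp only: N) (simp add: diff_divide_distrib algebra_simps)
    qed
    ultimately show ?thesis unfolding solution_def by blast
  qed
  \<comment> \<open>The fractional digits are fixed, so only the prefix in \<open>b\<close> and the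
    tail of the word grow.\<close>
  let ?p = "map Inl (b_word (int a + int m)) @ [Inr (Rep (replicate d Lb))] @
    map Inl (nf_digits k \<alpha> m I) @ [Inr (Geo (replicate N \<alpha>))]"
  have "flatten (fill (k ^ d) j) ?p \<in> ?A (n + j)" for j
  proof -
    have "b_word (?r (n + j) + int m) @ nf_digits k \<alpha> m (J j) = flatten (fill (k ^ d) j) ?p"
    proof -
      have "?r (n + j) + int m = (int a + int m) + int (d * j)"
        by (simp add: a_def algebra_simps)
      then have "b_word (?r (n + j) + int m) = b_word (int a + int m) @ replicate (d * j) Lb"
        by (simp only: b_word_add_nat[of "int a + int m"])
      moreover have "digits k \<alpha> m (J j) = digits k \<alpha> m I"
        by (rule digits_cong) (simp add: J_def)
      moreover have "J j div k ^ m = I div k ^ m + N * geo (k ^ d) j"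
        using k by (simp add: J_def)
      ultimately show ?thesis
        by (simp add: nf_digits_def replicate_add word_power_replicate del: map_replicate)
    qed
    moreover have "b_word (?r (n + j) + int m) @ nf_digits k \<alpha> m (J j) \<in> ?A (n + j)"
      using sol_J[of j] by (rule solution_wordsI)
    ultimately show ?thesis by (simp only:)
  qed
  then show "\<exists>N p'. \<forall>j. flatten (fill (k ^ d) j) p' \<in> ?A (N + j)" by blast
qed (use solution_words_unique[OF k d] in blast)

lemma frac_cancel: "u \<noteq> 0 \<Longrightarrow> v \<noteq> 0 \<Longrightarrow> a / u = b / (u * v) \<Longrightarrow> a * v = (b :: 'a::field)"
  by (simp add: divide_simps)

lemma power_int_minus_mult:
  assumes "k > 0"
  shows "(of_nat k :: rat) powi (r - int d * int j) * (of_nat k ^ d) ^ j = of_nat k powi r"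
proof -
  have "(of_nat k :: rat) powi (r - int d * int j) * of_nat k powi (int (d * j)) = of_nat k powi r"
    using assms by (simp flip: power_int_add)
  then show ?thesis by (simp only: power_int_of_nat power_mult)
qed

text \<open>For very negative \<open>r\<close>, passing from \<open>r\<close> to \<open>r - d\<close> adds \<open>d\<close> digits, keeps the prefix in \<open>b\<close>
  and does not affect the \<open>m - e\<close> lowest digits. The remaining part of the number follows the
  recursion in \<open>eventually_constant\<close>, hence the inserted digits are eventually periodic.\<close>

lemma pattern_language_decreasing:
  assumes k: "k \<ge> 2" and d: "d \<ge> 1" and p: "p \<noteq> 0" and i: "i \<le> 0"
  shows "pattern_language (k ^ d) (\<Union>n. solution_words \<alpha> k d p y e (i - int d * int n))"
proof (rule pattern_language_eventually)
  let ?r = "\<lambda>n. i - int d * int n"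
  let ?A = "\<lambda>n. solution_words \<alpha> k d p y e (?r n)"
  let ?k = "of_nat k :: rat" and ?K = "k ^ d"
  have k1: "?k \<ge> 1" "k > 0" using k by simp_all
  assume inf: "\<And>b. \<exists>n\<ge>b. ?A n \<noteq> {}"
  have r_le: "?r n \<le> - int n" for n
  proof -
    have "int 1 * int n \<le> int d * int n" using d by (intro mult_right_mono) auto
    then show ?thesis using i by linarith
  qed
  have r_anti: "?r n' \<le> ?r n" if "n \<le> n'" for n n'
    using that d by (simp add: mult_left_mono)
  obtain n m I where n: "n \<ge> nat \<bar>p\<bar>" and sol: "solution k d p y e (?r n) m I"
    using inf[of "nat \<bar>p\<bar>"] unfolding solution_words_def by blast
  have eq: "(?k ^ d - 1) * of_nat I / ?k ^ m = (of_int p * ?k powi ?r n - of_int y) / ?k ^ e"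
    and red: "reduced k m I" using sol by (simp_all add: solution_def)
  \<comment> \<open>For positive \<open>p\<close> the expression decreases with \<open>j\<close>,
    and a solution further on bounds it below; for negative \<open>p\<close> it increases from the
    solution at \<open>n\<close>.\<close>
  have nonneg: "of_int p * ?k powi ?r (n + j) - of_int y \<ge> 0" for j
  proof (cases "p > 0")
    case True
    obtain n' m' I' where n': "n' \<ge> n + j" "solution k d p y e (?r n') m' I'"
      using inf[of "n + j"] unfolding solution_words_def by blast
    have "of_int p * ?k powi ?r n' \<le> of_int p * ?k powi ?r (n + j)"
      using True r_anti[OF n'(1)] k1 by (intro mult_left_mono power_int_increasing) auto
    then show ?thesis using solution_nonneg[OF k n'(2)] by linarith
  next
    case False
    have "of_int p * ?k powi ?r n \<le> of_int p * ?k powi ?r (n + j)"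
      using False r_anti[of n "n + j"] k1 by (intro mult_left_mono_neg power_int_increasing) auto
    then show ?thesis using solution_nonneg[OF k sol] by linarith
  qed
  \<comment> \<open>Otherwise clearing denominators shows that $k^a$ divides the nonzero
    \<open>p\<close>, which is impossible because $k^a > a$ and \<open>n\<close> was chosen at least
    $|p|$.\<close>
  have "m > e"
  proof (rule ccontr)
    assume "\<not> m > e"
    then have pow: "?k ^ e = ?k ^ m * ?k ^ (e - m)" by (simp flip: power_add)
    have "(?k ^ d - 1) * of_nat I * ?k ^ (e - m) = of_int p * ?k powi ?r n - of_int y"
      by (rule frac_cancel[of "?k ^ m"]) (use eq k1 in \<open>simp_all add: pow\<close>)
    moreover define a where "a = nat (- ?r n)"
    have a: "?r n = - int a" and an: "a \<ge> n" using r_le[of n] by (simp_all add: a_def)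
    ultimately have "((?k ^ d - 1) * of_nat I * ?k ^ (e - m) + of_int y) * ?k ^ a = of_int p"
      using k1 by (simp add: a power_int_minus field_simps)
    then have "of_int (((int k ^ d - 1) * int I * int k ^ (e - m) + y) * int k ^ a) = (of_int p :: rat)"
      by simp
    then have "((int k ^ d - 1) * int I * int k ^ (e - m) + y) * int k ^ a = p"
      by (simp only: of_int_eq_iff)
    then have "int k ^ a dvd p" by (metis dvd_triv_right)
    then have "int k ^ a \<le> \<bar>p\<bar>" using p dvd_imp_le_int[of p "int k ^ a"] by simp
    moreover have "a < k ^ a" using k by (intro less_exp[THEN less_le_trans] power_mono) auto
    then have "int a < int k ^ a" by (metis of_nat_less_iff of_nat_power)
    ultimately show False using an n by linarith
  qed
  define M where "M = m - e"
  have m: "m = M + e" "M > 0" using \<open>m > e\<close> by (simp_all add: M_def)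
  \<comment> \<open>The numerator over $k^{m+dj}$ that the equation forces at the exponent
    \<open>?r (n + j)\<close>. It is taken as an integer until its sign is settled.\<close>
  define x where "x j = int I - y * int k ^ M * int (geo ?K j)" for j
  have x_Suc: "x (Suc j) = x j - y * int (k ^ (M + d * j))" for j
    by (simp add: x_def geo_Suc' power_add power_mult algebra_simps del: geo.simps)
  have x_eq: "(?k ^ d - 1) * of_int (x j) / ?k ^ (m + d * j) =
      (of_int p * ?k powi ?r (n + j) - of_int y) / ?k ^ e" for j
  proof -
    have geo: "(?k ^ d - 1) * of_nat (geo ?K j) = (?k ^ d) ^ j - 1"
      using arg_cong[OF geo_closed[of ?K j], of "of_int :: int \<Rightarrow> rat"] by simp
    have "(?k ^ d - 1) * of_int (x j) =
        (?k ^ d - 1) * of_nat I - of_int y * ?k ^ M * ((?k ^ d - 1) * of_nat (geo ?K j))"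
      by (simp add: x_def algebra_simps)
    also have "(?k ^ d - 1) * of_nat I = (of_int p * ?k powi ?r n - of_int y) * ?k ^ M"
      by (rule frac_cancel[of "?k ^ e", symmetric])
        (use eq k1 in \<open>simp_all add: m(1) power_add mult.commute\<close>)
    also have "?k powi ?r n = ?k powi ?r (n + j) * (?k ^ d) ^ j"
      using power_int_minus_mult[OF k1(2), of "?r n" d j] by (simp add: algebra_simps)
    finally have "(?k ^ d - 1) * of_int (x j) =
        (of_int p * ?k powi ?r (n + j) - of_int y) * (?k ^ M * (?k ^ d) ^ j)"
      unfolding geo by (simp add: algebra_simps)
    moreover have "?k ^ (m + d * j) = ?k ^ e * (?k ^ M * (?k ^ d) ^ j)"
      by (simp add: m(1) power_add power_mult)
    moreover have nonzero: "?k ^ M * (?k ^ d) ^ j \<noteq> 0" using k1 by simp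
    ultimately show ?thesis by (simp only: mult_divide_mult_cancel_right[OF nonzero])
  qed
  have x_nonneg: "x j \<ge> 0" for j
  proof -
    have "(?k ^ d - 1) * of_int (x j) / ?k ^ (m + d * j) \<ge> 0"
      unfolding x_eq using nonneg[of j] by simp
    moreover have "?k ^ (m + d * j) > 0" using k1 by simp
    ultimately have "(?k ^ d - 1) * of_int (x j) \<ge> 0"
      by (simp only: zero_le_divide_iff) linarith
    moreover have "?k ^ d > 1" using k d by (intro one_less_power) auto
    ultimately have "(of_int (x j) :: rat) \<ge> 0" by (simp add: zero_le_mult_iff)
    then show ?thesis by (simp only: of_int_0_le_iff)
  qed
  define J where "J j = nat (x j)" for j
  have J: "int (J j) = x j" for j using x_nonneg by (simp add: J_def)
  have red_J: "reduced k (m + d * j) (J j)" for j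
  proof -
    \<comment> \<open>As \<open>M > 0\<close>, the correction is a multiple of \<open>k\<close>, so
      the lowest digit stays nonzero.\<close>
    have "int k dvd y * int k ^ M * int (geo ?K j)" using m(2) by simp
    then have "int k dvd x j \<longleftrightarrow> int k dvd int I"
      unfolding x_def by (rule dvd_diff_left_iff)
    then have "k dvd J j \<longleftrightarrow> k dvd I" by (simp flip: J)
    then show ?thesis using red m by (simp add: reduced_def)
  qed
  have sol_J: "solution k d p y e (?r (n + j)) (m + d * j) (J j)" for j
    unfolding solution_def using red_J[of j] x_eq[of j] by (simp flip: J)
  \<comment> \<open>\<open>H j\<close> is what lies above the lowest $M + dj$ digits of
    \<open>J j\<close>, and \<open>Z j\<close> is what replaces it in \<open>J (Suc j)\<close>. The
    lowest \<open>d\<close> digits of \<open>Z j\<close> are the inserted ones; the rest is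
    \<open>H (Suc j)\<close>.\<close>
  define H where "H j = J j div k ^ (M + d * j)" for j
  define Z where "Z j = J (Suc j) div k ^ (M + d * j)" for j
  have Z_H: "int (Z j) = int (H j) - y" for j
  proof -
    let ?c = "int (k ^ (M + d * j))"
    have "(x j + (- y) * ?c) div ?c = - y + x j div ?c"
      using k1(2) by (intro div_mult_self1) simp
    then show ?thesis
      unfolding Z_def H_def zdiv_int J x_Suc by simp
  qed
  have H_Suc: "H (Suc j) = Z j div k ^ d" for j
    by (simp add: H_def Z_def power_add div_mult2_eq add.commute[of d] flip: add.assoc)
  have "\<exists>N. \<forall>j\<ge>N. int (H j) = int (H N)"
  proof (rule eventually_constant)
    show "int (H (Suc j)) = (int (H j) - y) div int ?K" for j
      by (simp add: H_Suc zdiv_int Z_H)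
    have "k ^ 1 \<le> k ^ d" using k d by (intro power_increasing) auto
    then have "2 \<le> k ^ d" using k by simp
    then have "int 2 \<le> int ?K" by (simp only: of_nat_le_iff)
    then show "int ?K \<ge> 2" by (simp only: of_nat_numeral)
  qed simp
  then obtain N where N: "\<And>j. j \<ge> N \<Longrightarrow> H j = H N" by auto
  have ZN: "Z j = Z N" if "j \<ge> N" for j
    using Z_H[of j] Z_H[of N] N[OF that] by linarith
  have digits_J: "digits k \<alpha> (M + d * (N + j)) (J (N + j)) =
      digits k \<alpha> (M + d * N) (J N) @ word_power (digits k \<alpha> d (Z N)) j" for j
  proof (induction j)
    case (Suc j)
    let ?q = "M + d * (N + j)"
    \<comment> \<open>The numerator changes by a multiple of $k$ to the power \<open>?q\<close>,
      which does not affect the digits below that position.\<close>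
    have "int (J (Suc (N + j)) mod k ^ ?q) = int (J (N + j) mod k ^ ?q)"
      unfolding zmod_int J x_Suc by (metis mod_diff_right_eq mod_mult_self2_is_0 diff_zero)
    then have cong: "digits k \<alpha> ?q (J (Suc (N + j))) = digits k \<alpha> ?q (J (N + j))"
      by (intro digits_cong) simp
    have "digits k \<alpha> (M + d * (N + Suc j)) (J (N + Suc j)) = digits k \<alpha> (?q + d) (J (Suc (N + j)))"
      by (simp add: algebra_simps)
    also have "\<dots> = digits k \<alpha> ?q (J (N + j)) @ digits k \<alpha> d (Z (N + j))"
      by (simp only: digits_add[of k \<alpha> ?q d] cong Z_def)
    also have "\<dots> = digits k \<alpha> (M + d * N) (J N) @ word_power (digits k \<alpha> d (Z N)) (Suc j)"
      unfolding Suc.IH ZN[OF le_add1] by (simp add: word_power_commute)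
    finally show ?case .
  qed simp
  \<comment> \<open>The prefix is fixed because \<open>r\<close> drops by \<open>d\<close> while
    \<open>d\<close> digits are added. The last \<open>e\<close> digits and the integer part come
    from the constant value \<open>H N\<close>.\<close>
  let ?p = "map Inl (b_word (?r n + int m) @ digits k \<alpha> (M + d * N) (J N)) @
    [Inr (Rep (digits k \<alpha> d (Z N)))] @ map Inl (nf_digits k \<alpha> e (H N))"
  have "flatten (fill ?K j) ?p \<in> ?A (n + N + j)" for j
  proof -
    have "m + d * (N + j) = M + d * (N + j) + e" by (simp add: m)
    then have "nf_digits k \<alpha> (m + d * (N + j)) (J (N + j)) =
        digits k \<alpha> (M + d * (N + j)) (J (N + j)) @ nf_digits k \<alpha> e (H (N + j))"
      by (simp only: nf_digits_add H_def)
    moreover have "flatten (fill ?K j) ?p = b_word (?r n + int m) @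
        digits k \<alpha> (M + d * (N + j)) (J (N + j)) @ nf_digits k \<alpha> e (H (N + j))"
      using N[OF le_add1] digits_J[of j] by simp
    moreover have "?r (n + (N + j)) + int (m + d * (N + j)) = ?r n + int m"
      by (simp add: algebra_simps)
    ultimately have "flatten (fill ?K j) ?p =
        b_word (?r (n + (N + j)) + int (m + d * (N + j))) @ nf_digits k \<alpha> (m + d * (N + j)) (J (N + j))"
      by (simp only:)
    then show ?thesis using solution_wordsI[OF sol_J[of "N + j"]] by (simp only: add.assoc)
  qed
  then show "\<exists>N p'. \<forall>j. flatten (fill ?K j) p' \<in> ?A (N + j)" by blast
qed (use solution_words_unique[OF k d] in blast)

text \<open>For \<open>p = 0\<close> the equation does not involve \<open>r\<close>, so at most one
  pair \<open>m\<close>, \<open>I\<close> solves it and the power of \<open>b\<close> is arbitrary.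
  Otherwise the integers \<open>r\<close> are split by sign and by residue modulo \<open>d\<close>
  into increasing and decreasing progressions.\<close>

lemma pattern_language_solutions:
  assumes k: "k \<ge> 2" and d: "d \<ge> 1"
  shows "pattern_language (k ^ d) (\<Union>r. solution_words \<alpha> k d p y e r)"
proof (cases "p = 0")
  case True
  then have indep: "solution k d p y e r m I \<longleftrightarrow> solution k d p y e 0 m I" for r m I
    by (simp add: solution_def)
  show ?thesis
  proof (cases "\<exists>m I. solution k d p y e 0 m I")
    case True
    then obtain m I where sol: "solution k d p y e 0 m I" by blast
    then have "solution k d p y e r n J \<longleftrightarrow> n = m \<and> J = I" for r n J
      using solution_unique[OF k d] indep by blast
    then have "(\<Union>r. solution_words \<alpha> k d p y e r) =
        (\<Union>r. {b_word (r + int m) @ nf_digits k \<alpha> m I})"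
      by (auto simp: solution_words_def)
    also have "\<dots> = (\<Union>t. {b_word t @ nf_digits k \<alpha> m I})"
    proof (intro equalityI UN_least)
      fix t
      show "{b_word t @ nf_digits k \<alpha> m I} \<subseteq> (\<Union>r. {b_word (r + int m) @ nf_digits k \<alpha> m I})"
        by (intro subsetI UN_I[of "t - int m"]) simp_all
    qed auto
    also have "\<dots> = (\<Union>x\<in>{Lb, LB}. range (\<lambda>n. flatten (fill (k ^ d) n)
        (Inr (Rep [x]) # map Inl (nf_digits k \<alpha> m I))))"
    proof (rule Set.set_eqI)
      fix w
      show "w \<in> (\<Union>t. {b_word t @ nf_digits k \<alpha> m I}) \<longleftrightarrow>
          w \<in> (\<Union>x\<in>{Lb, LB}. range (\<lambda>n. flatten (fill (k ^ d) n)
            (Inr (Rep [x]) # map Inl (nf_digits k \<alpha> m I))))"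
        using ex_b_word_iff[of w "nf_digits k \<alpha> m I"] by (simp add: word_power_singleton image_iff)
    qed
    finally show ?thesis
      by (simp only:) (intro pattern_language_UN pattern_language_pattern, simp)
  next
    case False
    then have "solution_words \<alpha> k d p y e r = {}" for r
      unfolding solution_words_def indep[of r] by simp
    then show ?thesis by (simp add: pattern_language_empty)
  qed
next
  case False
  have "(\<Union>r. solution_words \<alpha> k d p y e r) =
    (\<Union>i\<in>{..<d}. (\<Union>n. solution_words \<alpha> k d p y e (int i + int d * int n)) \<union>
      (\<Union>n. solution_words \<alpha> k d p y e (- 1 - int i - int d * int n)))" (is "?L = ?R")
  proof (intro equalityI subsetI)
    fix w assume "w \<in> ?L"
    then obtain r where r: "w \<in> solution_words \<alpha> k d p y e r" by blast
    have split: "int c = int (c mod d) + int d * int (c div d)" "c mod d < d" for c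
      using d by (simp_all flip: of_nat_mult of_nat_add)
    show "w \<in> ?R"
    proof (cases "r \<ge> 0")
      case True
      then obtain i n where "i < d" "r = int i + int d * int n"
        using split[of "nat r"] that[of "nat r mod d" "nat r div d"] by simp
      then show ?thesis using r by blast
    next
      case False
      then obtain i n where "i < d" "r = - 1 - int i - int d * int n"
        using split[of "nat (- 1 - r)"] that[of "nat (- 1 - r) mod d" "nat (- 1 - r) div d"] by simp
      then show ?thesis using r by blast
    qed
  qed blast
  then show ?thesis
    by (simp only:) (intro pattern_language_UN pattern_language_Un pattern_language_increasing
      pattern_language_decreasing, use assms False in auto)
qed

subsection \<open>The set of conjugators\<close>

text \<open>Multiplying by the sign \<open>s\<close> for positive \<open>c\<close>, and by $-s
  k^{|c|}$ for negative \<open>c\<close>, turns the factor $k^c - 1$ into $k^{|c|} - 1$. The right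
  side is then brought to the common denominator $k^{j+j'}$.\<close>

lemma conjugacy_equation:
  fixes A B :: rat
  assumes "k > 0" "c \<noteq> 0" "\<sigma> = 1 \<or> \<sigma> = - 1"
    and A: "A = of_int i / of_nat k ^ j" and B: "B = of_int i' / of_nat k ^ j'"
  shows "\<exists>p y e. \<forall>x R. \<sigma> * x * (of_nat k powi c - 1) = A * R - B \<longleftrightarrow>
    (of_nat k ^ nat \<bar>c\<bar> - 1) * x = (of_int p * R - of_int y) / of_nat k ^ e"
proof -
  let ?d = "nat \<bar>c\<bar>"
  obtain s :: int where s: "\<sigma> = of_int s" "s * s = 1"
    using assms(3) by (metis minus_mult_minus mult_1 of_int_1 of_int_minus)
  have "\<exists>\<delta> :: int. \<forall>x R. \<sigma> * x * (of_nat k powi c - 1) = A * R - B \<longleftrightarrow>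
    (of_nat k ^ ?d - 1) * x = of_int \<delta> * (A * R - B)"
  proof (cases "c > 0")
    case True
    then have "(of_nat k powi c :: rat) = of_nat k ^ ?d" by (simp add: power_int_def)
    then show ?thesis using assms(3) s
      by (intro exI[of _ s]) (auto simp: algebra_simps)
  next
    case False
    then have pow: "of_nat k powi c * (of_nat k ^ ?d :: rat) = 1"
      using assms(1) by (simp add: power_int_def power_inverse)
    have "\<sigma> * x * (of_nat k powi c - 1) = A * R - B \<longleftrightarrow>
        (of_nat k ^ ?d - 1) * x = of_int (- s * int k ^ ?d) * (A * R - B)" for x R
    proof -
      have "\<sigma> * x * (of_nat k powi c - 1) = A * R - B \<longleftrightarrow>
          of_int (- s * int k ^ ?d) * (\<sigma> * x * (of_nat k powi c - 1)) = of_int (- s * int k ^ ?d) * (A * R - B)"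
        using assms(1) s(2) by auto
      also have "of_int (- s * int k ^ ?d) * (\<sigma> * x * (of_nat k powi c - 1)) =
          of_int (s * s) * x * (of_nat k ^ ?d - of_nat k powi c * of_nat k ^ ?d)"
        by (simp add: s(1) algebra_simps)
      finally show ?thesis by (simp add: s(2) pow mult.commute)
    qed
    then show ?thesis by blast
  qed
  then obtain \<delta> :: int where \<delta>: "\<And>x R. \<sigma> * x * (of_nat k powi c - 1) = A * R - B \<longleftrightarrow>
    (of_nat k ^ ?d - 1) * x = of_int \<delta> * (A * R - B)" by blast
  have "of_int \<delta> * (A * R - B) =
      (of_int (\<delta> * i * int k ^ j') * R - of_int (\<delta> * i' * int k ^ j)) / of_nat k ^ (j + j')" for R
    using assms(1) by (simp add: A B power_add field_simps)
  then show ?thesis using \<delta> by metis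
qed

lemma EDT0L_empty: "EDT0L ({} :: 'a::finite list set)"
  using EDT0L_pattern_language[OF pattern_language_empty] .

text \<open>Each sign \<open>\<alpha>\<close> has its own parameters \<open>p\<close>,
  \<open>y\<close>, \<open>e\<close>, and the conjugators are the solution words for both signs. If
  the exponent sums of \<open>b\<close> differ, there are no conjugators.\<close>

lemma EDT0L_Con_nonzero_exponent:
  assumes k: "k \<ge> 2" and "bexp v \<noteq> 0"
  shows "EDT0L (Con k (eval_word k v) (eval_word k u))"
proof (cases "bexp u = bexp v")
  case True
  let ?d = "nat \<bar>bexp v\<bar>"
  have "k > 0" using k by simp
  obtain i j where u: "aval k u = of_int i / of_nat k ^ j" using \<open>k > 0\<close> by (rule aval_fraction)
  obtain i' j' where v: "aval k v = of_int i' / of_nat k ^ j'" using \<open>k > 0\<close> by (rule aval_fraction)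
  have "\<forall>\<alpha>. \<exists>p y e. \<forall>x R. letter_sign \<alpha> * x * (of_nat k powi bexp v - 1) = aval k u * R - aval k v \<longleftrightarrow>
    (of_nat k ^ ?d - 1) * x = (of_int p * R - of_int y) / of_nat k ^ e"
  proof
    fix \<alpha>
    have "letter_sign \<alpha> = 1 \<or> letter_sign \<alpha> = - 1" by (cases \<alpha>) simp_all
    then show "\<exists>p y e. \<forall>x R. letter_sign \<alpha> * x * (of_nat k powi bexp v - 1) = aval k u * R - aval k v \<longleftrightarrow>
      (of_nat k ^ ?d - 1) * x = (of_int p * R - of_int y) / of_nat k ^ e"
      using \<open>k > 0\<close> assms(2) u v by (intro conjugacy_equation)
  qed
  then obtain p y e where pye: "\<And>\<alpha> x R. letter_sign \<alpha> * x * (of_nat k powi bexp v - 1) = aval k u * R - aval k v \<longleftrightarrow>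
    (of_nat k ^ ?d - 1) * x = (of_int (p \<alpha>) * R - of_int (y \<alpha>)) / of_nat k ^ e \<alpha>"
    by metis
  have eq: "letter_sign \<alpha> * of_nat I / of_nat k ^ m * (of_nat k powi bexp v - 1) =
      aval k u * of_nat k powi r - aval k v \<longleftrightarrow>
    (of_nat k ^ ?d - 1) * of_nat I / of_nat k ^ m =
      ((of_int (p \<alpha>) * of_nat k powi r - of_int (y \<alpha>)) / of_nat k ^ e \<alpha> :: rat)" for \<alpha> I m r
    using pye[of \<alpha> "of_nat I / of_nat k ^ m" "of_nat k powi r"] by simp
  have "Con k (eval_word k v) (eval_word k u) =
      (\<Union>\<alpha>\<in>{La, LA}. \<Union>r. solution_words \<alpha> k ?d (p \<alpha>) (y \<alpha>) (e \<alpha>) r)" (is "_ = ?R")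
  proof (intro equalityI subsetI)
    fix w assume "w \<in> Con k (eval_word k v) (eval_word k u)"
    then obtain t \<alpha> m I where w: "w = b_word t @ nf_digits k \<alpha> m I" "\<alpha> = La \<or> \<alpha> = LA"
      "reduced k m I" "letter_sign \<alpha> * of_nat I / of_nat k ^ m * (of_nat k powi bexp v - 1) =
        aval k u * of_nat k powi (t - int m) - aval k v"
      unfolding Con_eq[OF \<open>k > 0\<close>] by blast
    then have "solution k ?d (p \<alpha>) (y \<alpha>) (e \<alpha>) (t - int m) m I"
      unfolding solution_def eq by blast
    then have "b_word (t - int m + int m) @ nf_digits k \<alpha> m I \<in>
        solution_words \<alpha> k ?d (p \<alpha>) (y \<alpha>) (e \<alpha>) (t - int m)" by (rule solution_wordsI)
    then show "w \<in> ?R" using w(1,2) by (simp only: diff_add_cancel) blast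
  next
    fix w assume "w \<in> ?R"
    then obtain \<alpha> r m I where w: "\<alpha> = La \<or> \<alpha> = LA" "w = b_word (r + int m) @ nf_digits k \<alpha> m I"
      "solution k ?d (p \<alpha>) (y \<alpha>) (e \<alpha>) r m I"
      unfolding solution_words_def by blast
    have "letter_sign \<alpha> * of_nat I / of_nat k ^ m * (of_nat k powi bexp v - 1) =
        aval k u * of_nat k powi (r + int m - int m) - aval k v" "reduced k m I"
      using w(3) unfolding solution_def eq[symmetric] by simp_all
    then show "w \<in> Con k (eval_word k v) (eval_word k u)"
      unfolding Con_eq[OF \<open>k > 0\<close>] using w(1,2) True by blast
  qed
  moreover have "?d \<ge> 1" using assms(2) by simp
  ultimately have "pattern_language (k ^ ?d) (Con k (eval_word k v) (eval_word k u))"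
    by (simp only:) (intro pattern_language_UN pattern_language_solutions k, simp)
  then show ?thesis by (rule EDT0L_pattern_language)
next
  case False
  then have "Con k (eval_word k v) (eval_word k u) = {}"
    using k by (simp add: Con_eq)
  then show ?thesis by (simp add: EDT0L_empty)
qed

text \<open>The factor $k^c - 1$ vanishes, so besides equal exponent sums only $q_g k^r = q_h$
  remains, which does not involve the exponent of \<open>a\<close>. It holds for no
  \<open>r\<close>, for all \<open>r\<close> if $q_g = q_h = 0$, or, as the powers of
  \<open>k\<close> are distinct, for exactly one \<open>r\<close>.\<close>

lemma EDT0L_Con_zero_exponent:
  assumes k: "k \<ge> 2" and v: "bexp v = 0"
  shows "EDT0L (Con k (eval_word k v) (eval_word k u))"
proof -
  let ?P = "\<lambda>r. bexp u = 0 \<and> aval k u * of_nat k powi r = aval k v"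
  have "k > 0" using k by simp
  have Con: "Con k (eval_word k v) (eval_word k u) = {b_word t @ nf_digits k \<alpha> m I | t \<alpha> m I.
      (\<alpha> = La \<or> \<alpha> = LA) \<and> reduced k m I \<and> ?P (t - int m)}"
    unfolding Con_eq[OF \<open>k > 0\<close>] using v by auto
  show ?thesis
  proof (cases "\<exists>r. ?P r")
    case False
    then have "Con k (eval_word k v) (eval_word k u) = {}" unfolding Con by blast
    then show ?thesis by (simp add: EDT0L_empty)
  next
    case True
    then obtain r where r: "?P r" by blast
    show ?thesis
    proof (cases "aval k u = 0")
      case True
      then have "?P s" for s using r by simp
      then have "Con k (eval_word k v) (eval_word k u) = NF k"
        unfolding Con NF_eq[OF \<open>k > 0\<close>] by simp
      then show ?thesis using EDT0L_NF[OF \<open>k > 0\<close>] by simp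
    next
      case False
      have "?P s \<longleftrightarrow> s = r" for s
      proof
        assume "?P s"
        then have "aval k u * of_nat k powi s = aval k u * of_nat k powi r" using r by simp
        then have "(of_nat k powi s :: rat) = of_nat k powi r" using False by simp
        moreover have "(1 :: rat) < of_nat k" using k by simp
        ultimately show "s = r"
          using power_int_strict_increasing[of s r "of_nat k :: rat"]
            power_int_strict_increasing[of r s "of_nat k :: rat"] by (metis less_irrefl linorder_neqE)
      qed (use r in simp)
      then have "Con k (eval_word k v) (eval_word k u) =
          {b_word (r + int m) @ nf_digits k \<alpha> m I | m \<alpha> I. (\<alpha> = La \<or> \<alpha> = LA) \<and> reduced k m I}"
        unfolding Con by (auto simp: algebra_simps)
      then show ?thesis using EDT0L_fixed_b_exponent[OF \<open>k > 0\<close>] by simp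
    qed
  qed
qed

theorem proposition9:
  fixes k :: nat and g h :: "letter list set"
  assumes "k \<ge> 2" and "g \<in> carrier (BS k)" and "h \<in> carrier (BS k)"
  shows "EDT0L (Con k h g)"
proof -
  obtain u where "g = eval_word k u" using assms(2) by (rule carrier_BS_cases)
  moreover obtain v where "h = eval_word k v" using assms(3) by (rule carrier_BS_cases)
  ultimately show ?thesis
    using assms(1) EDT0L_Con_zero_exponent EDT0L_Con_nonzero_exponent by metis
qed

end
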